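(* Consider the bimodal Filippov system $\dot x=f(x)$ on an open set $U\subseteq\mathbb{R}^n$, with $f(x)=f^+(x)$ if $x\in\mathcal{S}^+=\{x\in U: H(x)>0\}$ and $f(x)=f^-(x)$ if $x\in\mathcal{S}^-=\{x\in U: H(x)<0\}$, and switching manifold $\Sigma=\{x\in U:H(x)=0\}$. Let $\mathcal{C}\subseteq U$ be a forward-invariant $K$-reachable set. Suppose there exist a norm, with associated matrix measure $\mu$, and positive constants $c_1,c_2$ such that $$\mu\left(\frac{\partial f^+}{\partial x}(x)\right)\le -c_1\quad\forall x\in\bar{\mathcal{S}}^+,$$ $$\mu\left(\frac{\partial f^-}{\partial x}(x)\right)\le -c_2\quad\forall x\in\bar{\mathcal{S}}^-,$$ $$\mu\left(\big[f^+(x)-f^-(x)\big]\,\nabla H(x)\right)=0\quad\forall x\in\Sigma .$$ Then the bimodal Filippov system is incrementally exponentially stable in $\mathcal{C}$ with convergence rate $c:=\min\{c_1,c_2\}$.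
   Context: Bimodal Filippov system: $U\subseteq\mathbb{R}^n$ is open, $f^+,f^-\in C^1(U,\mathbb{R}^n)$, $H:U\to\mathbb{R}$ is smooth with $0$ a regular value, i.e. $\nabla H(x)=[\partial H/\partial x_1\ \dots\ \partial H/\partial x_n]\ne0$ (a row vector) for all $x\in\Sigma$. $\bar{\mathcal{S}}^\pm$ denotes the closure of $\mathcal{S}^\pm$ (in $U$). $[f^+(x)-f^-(x)]\nabla H(x)$ is the $n\times n$ matrix given by column times row. Standing assumption: solutions are understood in the sense of Filippov (in the sliding region $\{x\in\Sigma:\nabla H f^+<0<\nabla H f^-\}$ the motion follows the convex combination $f^s=(1-\lambda)f^++\lambda f^-$, $\lambda\in[0,1]$, with $\nabla H f^s=0$), and right uniqueness of solutions holds in $U$ (so the escaping region, the set of $x\in\Sigma$ with $\nabla H f^+>0$ and $\nabla H f^-<0$, is excluded). Matrix measure: for a norm $|\cdot|$ on $\mathbb{R}^n$ with induced matrix norm $\|\cdot\|$, $\mu(A)=\lim_{h\to0^+}\frac{\|I+hA\|-1}{h}$. $K$-reachable: $\mathcal{C}\subseteq\mathbb{R}^n$ is $K$-reachable ($K>0$) if for any $x_0,y_0\in\mathcal{C}$ there is a continuously differentiable curve $\gamma:[0,1]\to\mathcal{C}$ with $\gamma(0)=x_0$, $\gamma(1)=y_0$, $|\gamma'(r)|\le K|y_0-x_0|$ for all $r$. Forward invariant: solutions starting in $\mathcal{C}$ at time $t_0$ stay in $\mathcal{C}$ for all $t\ge t_0$. Incrementally exponentially stable in the forward-invariant set $\mathcal{C}$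 with convergence rate $c>0$: there is a constant $K\ge1$ such that any two solutions $x(t),y(t)$ with $x(t_0)=x_0\in\mathcal{C}$, $y(t_0)=y_0\in\mathcal{C}$ satisfy $|x(t)-y(t)|\le K e^{-c(t-t_0)}|x_0-y_0|$ for all $t\ge t_0$, in the given norm. *)

theory Defs
  imports "HOL-Analysis.Analysis"
begin

text \<open>Meant for open \<open>U\<close>: all derivatives are two-sided.\<close>

primrec Ck_on ::
  "nat \<Rightarrow> ('a::euclidean_space \<Rightarrow> 'b::real_normed_vector) \<Rightarrow> 'a set \<Rightarrow> bool" where
  "Ck_on 0 f U \<longleftrightarrow> continuous_on U f"
| "Ck_on (Suc k) f U \<longleftrightarrow>
     (\<forall>x\<in>U. f differentiable (at x)) \<and>
     (\<forall>b\<in>Basis. Ck_on k (\<lambda>x. frechet_derivative f (at x) b) U)"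

definition smooth_on :: "('a::euclidean_space \<Rightarrow> 'b::real_normed_vector) \<Rightarrow> 'a set \<Rightarrow> bool" where
  "smooth_on f U \<longleftrightarrow> (\<forall>k. Ck_on k f U)"

definition grad :: "(real^'n \<Rightarrow> real) \<Rightarrow> real^'n \<Rightarrow> real^'n" where
  "grad H x = (\<chi> i. frechet_derivative H (at x) (axis i 1))"


text \<open>Norms are predicates, since the type class norm on vectors is the Euclidean one only.\<close>

definition is_norm :: "('a::real_vector \<Rightarrow> real) \<Rightarrow> bool" where
  "is_norm N \<longleftrightarrow>
     (\<forall>x. N x \<ge> 0) \<and>
     (\<forall>x. N x = 0 \<longleftrightarrow> x = 0) \<and>
     (\<forall>a x. N (a *\<^sub>R x) = \<bar>a\<bar> * N x) \<and>
     (\<forall>x y. N (x + y) \<le> N x + N y)"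

definition induced_norm :: "(real^'n \<Rightarrow> real) \<Rightarrow> real^'n^'n \<Rightarrow> real" where
  "induced_norm N A = (SUP x\<in>{x. N x = 1}. N (A *v x))"

definition matrix_measure :: "(real^'n \<Rightarrow> real) \<Rightarrow> real^'n^'n \<Rightarrow> real" where
  "matrix_measure N A =
     Lim (at_right 0) (\<lambda>h. (induced_norm N (mat 1 + h *\<^sub>R A) - 1) / h)"

definition K_reachable :: "('a::real_normed_vector \<Rightarrow> real) \<Rightarrow> real \<Rightarrow> 'a set \<Rightarrow> bool" where
  "K_reachable N K C \<longleftrightarrow> K > 0 \<and>
     (\<forall>x0\<in>C. \<forall>y0\<in>C. \<exists>\<gamma> \<gamma>'.
        (\<forall>r\<in>{0..1}. \<gamma> r \<in> C) \<and> \<gamma> 0 = x0 \<and> \<gamma> 1 = y0 \<and>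
        (\<forall>r\<in>{0..1}. (\<gamma> has_vector_derivative \<gamma>' r) (at r within {0..1})) \<and>
        continuous_on {0..1} \<gamma>' \<and>
        (\<forall>r\<in>{0..1}. N (\<gamma>' r) \<le> K * N (y0 - x0)))"


definition S_plus :: "'a set \<Rightarrow> ('a \<Rightarrow> real) \<Rightarrow> 'a set" where
  "S_plus U H = {x\<in>U. H x > 0}"

definition S_minus :: "'a set \<Rightarrow> ('a \<Rightarrow> real) \<Rightarrow> 'a set" where
  "S_minus U H = {x\<in>U. H x < 0}"

definition switching_manifold :: "'a set \<Rightarrow> ('a \<Rightarrow> real) \<Rightarrow> 'a set" where
  "switching_manifold U H = {x\<in>U. H x = 0}"

text \<open>Filippov's set-valued regularization of a vector field \<open>f\<close> defined on \<open>D\<close>: all values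
  near \<open>x\<close> count, except those on null sets.\<close>

definition filippov_map ::
  "('a::euclidean_space) set \<Rightarrow> ('a \<Rightarrow> 'a) \<Rightarrow> 'a \<Rightarrow> 'a set" where
  "filippov_map D f x =
     (\<Inter>\<delta>\<in>{0<..}. \<Inter>Z\<in>{Z. negligible Z}. closure (convex hull (f ` (ball x \<delta> \<inter> D - Z))))"

text \<open>The vector field of a bimodal system is left undefined on the switching manifold. There the
  value of the set-valued map below is the segment from \<open>fm x\<close> to \<open>fp x\<close> (if \<open>0\<close> is a regular
  value of \<open>H\<close>), so that sliding motion follows the convex combination tangent to the manifold;
  off the manifold it is \<open>{fp x}\<close> or \<open>{fm x}\<close>.\<close>

definition bimodal_map ::
  "'a set \<Rightarrow> ('a \<Rightarrow> real) \<Rightarrow> ('a \<Rightarrow> 'a) \<Rightarrow> ('a \<Rightarrow> 'a) \<Rightarrow> ('a::euclidean_space) \<Rightarrow> 'a set" where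
  "bimodal_map U H fp fm =
     filippov_map (S_plus U H \<union> S_minus U H) (\<lambda>x. if x \<in> S_plus U H then fp x else fm x)"

definition abs_continuous_on :: "real \<Rightarrow> real \<Rightarrow> (real \<Rightarrow> 'a::real_normed_vector) \<Rightarrow> bool" where
  "abs_continuous_on a b x \<longleftrightarrow>
     (\<forall>\<epsilon>>0. \<exists>\<delta>>0. \<forall>(m::nat) u v.
        (\<forall>k<m. a \<le> u k \<and> u k \<le> v k \<and> v k \<le> b) \<and>
        disjoint_family_on (\<lambda>k. {u k<..<v k}) {..<m} \<and>
        (\<Sum>k<m. v k - u k) < \<delta>
        \<longrightarrow> (\<Sum>k<m. norm (x (v k) - x (u k))) < \<epsilon>)"

text \<open>Solutions of the differential inclusion \<open>x' \<in> F x\<close> in \<open>U\<close> on an interval \<open>I\<close>. Only the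
  values of \<open>x\<close> on \<open>I\<close> matter.\<close>

definition inclusion_solution ::
  "('a::euclidean_space) set \<Rightarrow> ('a \<Rightarrow> 'a set) \<Rightarrow> real set \<Rightarrow> (real \<Rightarrow> 'a) \<Rightarrow> bool" where
  "inclusion_solution U F I x \<longleftrightarrow>
     (\<forall>t\<in>I. x t \<in> U) \<and>
     (\<forall>a b. a \<le> b \<and> {a..b} \<subseteq> I \<longrightarrow> abs_continuous_on a b x) \<and>
     (AE t in lebesgue. t \<in> I \<longrightarrow>
        (\<exists>v\<in>F (x t). (x has_vector_derivative v) (at t within I)))"

definition right_uniqueness :: "('a::euclidean_space) set \<Rightarrow> ('a \<Rightarrow> 'a set) \<Rightarrow> bool" where
  "right_uniqueness U F \<longleftrightarrow>
     (\<forall>t0 t1 x y. inclusion_solution U F {t0..t1} x \<and> inclusion_solution U F {t0..t1} y \<and>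
        x t0 = y t0 \<longrightarrow> (\<forall>t\<in>{t0..t1}. x t = y t))"

text \<open>Forward invariance is a statement about all \<open>t \<ge> t0\<close>: solutions starting in \<open>C\<close> neither
  leave \<open>C\<close> nor cease to exist in finite time.\<close>

definition forward_invariant ::
  "('a::euclidean_space) set \<Rightarrow> ('a \<Rightarrow> 'a set) \<Rightarrow> 'a set \<Rightarrow> bool" where
  "forward_invariant U F C \<longleftrightarrow>
     (\<forall>t0. \<forall>x0\<in>C. \<exists>x. inclusion_solution U F {t0..} x \<and> x t0 = x0) \<and>
     (\<forall>t0 t1 x. inclusion_solution U F {t0..t1} x \<and> x t0 \<in> C \<longrightarrow> (\<forall>t\<in>{t0..t1}. x t \<in> C))"

definition incr_exp_stable ::
  "('a::euclidean_space \<Rightarrow> real) \<Rightarrow> 'a set \<Rightarrow> ('a \<Rightarrow> 'a set) \<Rightarrow> 'a set \<Rightarrow> real \<Rightarrow> bool" where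
  "incr_exp_stable N U F C c \<longleftrightarrow> c > 0 \<and> forward_invariant U F C \<and>
     (\<exists>K\<ge>1. \<forall>t0 x y.
        inclusion_solution U F {t0..} x \<and> inclusion_solution U F {t0..} y \<and> x t0 \<in> C \<and> y t0 \<in> C
        \<longrightarrow> (\<forall>t\<ge>t0. N (x t - y t) \<le> K * exp (- c * (t - t0)) * N (x t0 - y t0)))"

end

theory Submission
  imports Defs
begin

text \<open>Regularizing the vector field is avoided; two solutions are compared directly. Write
  \<open>u = fp - fm\<close>. If two nearby points \<open>x\<close>, \<open>y\<close> satisfy \<open>H x \<ge> 0 \<ge> H y\<close>, then \<open>H\<close> vanishes at some
  point \<open>z\<close> of the segment from \<open>y\<close> to \<open>x\<close> with \<open>\<nabla>H(z) \<bullet> (x - y) \<ge> 0\<close>, and the condition on the rank-one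
  matrix \<open>u(z) \<nabla>H(z)\<close> says that subtracting a nonnegative multiple of \<open>u(z)\<close> from \<open>x - y\<close> does not
  decrease the norm. For Filippov velocities \<open>v = l fp(x) + (1 - l) fm(x)\<close> and
  \<open>w = m fp(y) + (1 - m) fm(y)\<close> with \<open>l \<ge> m\<close>, the vector \<open>v - w - (l - m) u(z)\<close> is a convex
  combination of \<open>fp(x) - fp(y)\<close>, \<open>fm(x) - fm(y)\<close> and \<open>(fp(x) - fp(z)) + (fm(z) - fm(y))\<close>, each of
  which contracts the distance at the rate \<open>c\<close>. The crossing point is needed at the perturbed
  time \<open>t + h\<close>, for a sequence of \<open>h\<close> tending to \<open>0\<close>; this is available unless \<open>t\<close> is isolated from
  the right among the times at which one or both solutions lie on the switching manifold, and such
  times are countable. So the distance of nearby solutions decays at every rate below \<open>c\<close>, by an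
  absolutely continuous comparison argument, and integrating along a path of initial values in
  the \<open>K\<close>-reachable set gives the global estimate with overshoot \<open>max 1 K\<close>.\<close>

subsection \<open>Norms given as functions\<close>

lemma is_norm_nonneg: "is_norm N \<Longrightarrow> 0 \<le> N x"
  and is_norm_eq_0_iff: "is_norm N \<Longrightarrow> N x = 0 \<longleftrightarrow> x = 0"
  and is_norm_scaleR: "is_norm N \<Longrightarrow> N (a *\<^sub>R x) = \<bar>a\<bar> * N x"
  and is_norm_triangle: "is_norm N \<Longrightarrow> N (x + y) \<le> N x + N y"
  by (simp_all add: is_norm_def)

lemma is_norm_zero: "is_norm N \<Longrightarrow> N 0 = 0"
  by (simp add: is_norm_eq_0_iff)

lemma is_norm_minus: "is_norm N \<Longrightarrow> N (- x) = N x"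
  using is_norm_scaleR[of N "-1" x] by simp

lemma is_norm_minus_commute: "is_norm N \<Longrightarrow> N (x - y) = N (y - x)"
  using is_norm_minus[of N "x - y"] by simp

lemma is_norm_triangle_sub: "is_norm N \<Longrightarrow> N x \<le> N y + N (x - y)"
  using is_norm_triangle[of N y "x - y"] by simp

lemma is_norm_diff_triangle: "is_norm N \<Longrightarrow> N (x - z) \<le> N (x - y) + N (y - z)"
  using is_norm_triangle[of N "x - y" "y - z"] by simp

lemma is_norm_abs_diff: "is_norm N \<Longrightarrow> \<bar>N x - N y\<bar> \<le> N (x - y)"
  using is_norm_triangle_sub[of N x y] is_norm_triangle_sub[of N y x]
  by (simp add: is_norm_minus_commute[of N y x])

lemma is_norm_sum_le:
  assumes "is_norm N"
  shows "N (sum f A) \<le> (\<Sum>i\<in>A. N (f i))"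
proof (induction A rule: infinite_finite_induct)
  case (insert x F)
  then show ?case using is_norm_triangle[OF assms, of "f x" "sum f F"] by simp
qed (simp_all add: is_norm_zero[OF assms])

lemma is_norm_le_norm:
  fixes N :: "'a::euclidean_space \<Rightarrow> real"
  assumes "is_norm N"
  shows "\<exists>M>0. \<forall>x. N x \<le> M * norm x"
proof (intro exI conjI allI)
  let ?M = "1 + (\<Sum>b\<in>Basis. N b)"
  have S: "0 \<le> (\<Sum>b\<in>Basis. N b)" by (simp add: sum_nonneg is_norm_nonneg[OF assms])
  show "?M > 0" using S by linarith
  fix x :: 'a
  have "N x = N (\<Sum>b\<in>Basis. (x \<bullet> b) *\<^sub>R b)" by (simp add: euclidean_representation)
  also have "\<dots> \<le> (\<Sum>b\<in>Basis. N ((x \<bullet> b) *\<^sub>R b))" by (rule is_norm_sum_le[OF assms])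
  also have "\<dots> \<le> (\<Sum>b\<in>Basis. norm x * N b)"
    by (intro sum_mono) (auto simp: is_norm_scaleR[OF assms] intro!: mult_right_mono
        Basis_le_norm is_norm_nonneg[OF assms])
  also have "\<dots> \<le> ?M * norm x"
    unfolding sum_distrib_left[symmetric] by (simp add: algebra_simps)
  finally show "N x \<le> ?M * norm x" .
qed

lemma is_norm_lipschitz:
  fixes N :: "'a::euclidean_space \<Rightarrow> real"
  assumes "is_norm N"
  shows "\<exists>M>0. (\<forall>x. N x \<le> M * norm x) \<and> (\<forall>x y. \<bar>N x - N y\<bar> \<le> M * norm (x - y))"
  using is_norm_le_norm[OF assms] is_norm_abs_diff[OF assms] by (meson order_trans)

lemma is_norm_continuous_on:
  fixes N :: "'a::euclidean_space \<Rightarrow> real"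
  assumes "is_norm N"
  shows "continuous_on S N"
proof -
  obtain M where "M > 0" "\<And>x. N x \<le> M * norm x" "\<And>x y. \<bar>N x - N y\<bar> \<le> M * norm (x - y)"
    using is_norm_lipschitz[OF assms] by blast
  then have "M-lipschitz_on S N" by (auto simp: lipschitz_on_def dist_norm)
  then show ?thesis by (rule lipschitz_on_continuous_on)
qed

lemma is_norm_ge_norm:
  fixes N :: "'a::euclidean_space \<Rightarrow> real"
  assumes "is_norm N"
  shows "\<exists>M>0. \<forall>x. norm x \<le> M * N x"
proof -
  have "sphere (0::'a) 1 \<noteq> {}" by simp
  then obtain s where s: "s \<in> sphere 0 1" "\<And>x. x \<in> sphere 0 1 \<Longrightarrow> N s \<le> N x"
    using continuous_attains_inf[OF compact_sphere _ is_norm_continuous_on[OF assms]] by blast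
  then have "N s > 0"
    using is_norm_nonneg[OF assms, of s] is_norm_eq_0_iff[OF assms, of s] by fastforce
  show ?thesis
  proof (intro exI conjI allI)
    show "1 / N s > 0" using \<open>N s > 0\<close> by simp
    fix x :: 'a
    show "norm x \<le> 1 / N s * N x"
    proof (cases "x = 0")
      case False
      then have "N s \<le> N ((1 / norm x) *\<^sub>R x)" by (intro s) simp
      then show ?thesis using False \<open>N s > 0\<close>
        by (simp add: is_norm_scaleR[OF assms] field_simps)
    qed (simp add: is_norm_zero[OF assms])
  qed
qed

subsection \<open>Growth estimates from one-sided increments\<close>

text \<open>The set of times at which the estimate holds with an extra slope \<open>e\<close>
  contains its supremum, because \<open>g\<close> is continuous and the monotone \<open>V\<close>
  can only jump upwards; a step from that supremum would lead beyond it. One step length per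
  starting time is enough, which matters because good steps for two solutions are available only
  along sequences tending to 0.\<close>

lemma growth_le_by_right_steps:
  fixes g V :: "real \<Rightarrow> real"
  assumes "a \<le> b" and g: "continuous_on {a..b} g" and V: "mono_on {a..b} V"
    and step: "\<And>t e. a \<le> t \<Longrightarrow> t < b \<Longrightarrow> e > 0 \<Longrightarrow>
      \<exists>h>0. t + h \<le> b \<and> g (t + h) - g t \<le> e * h + (V (t + h) - V t)"
  shows "g b - g a \<le> V b - V a"
proof (rule field_le_epsilon)
  fix e0 :: real assume "e0 > 0"
  \<comment> \<open>The summand 1 keeps the denominator positive for \<open>a = b\<close>, and
    \<open>e * (b - a)\<close> is at most \<open>e0\<close>.\<close>
  define e where "e = e0 / (b - a + 1)"
  have "e > 0" using \<open>e0 > 0\<close> \<open>a \<le> b\<close> by (simp add: e_def)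
  define S where "S = {t \<in> {a..b}. g t - g a \<le> e * (t - a) + (V t - V a)}"
  define T where "T = Sup S"
  have aS: "a \<in> S" using \<open>a \<le> b\<close> by (simp add: S_def)
  have bdd: "bdd_above S" by (rule bdd_aboveI[of _ b]) (simp add: S_def)
  have T: "a \<le> T" "T \<le> b"
  proof -
    show "a \<le> T" unfolding T_def by (rule cSup_upper[OF aS bdd])
    show "T \<le> b" unfolding T_def by (rule cSup_least) (use aS in \<open>auto simp: S_def\<close>)
  qed
  have "g T - g a \<le> e * (T - a) + (V T - V a)"
  proof (rule field_le_epsilon)
    fix d :: real assume "d > 0"
    then obtain k where k: "k > 0" "\<And>s. s \<in> {a..b} \<Longrightarrow> dist s T < k \<Longrightarrow> dist (g s) (g T) < d"
      using g[unfolded continuous_on_iff, rule_format, of T d] T by auto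
    obtain s where s: "s \<in> S" "T - k < s"
      using less_cSupD[of S "T - k"] aS k(1) unfolding T_def by auto
    have "s \<le> T" using s(1) bdd cSup_upper unfolding T_def by blast
    then have "\<bar>g s - g T\<bar> < d" using k(2)[of s] s by (auto simp: S_def dist_real_def)
    moreover have "V s \<le> V T" using V \<open>s \<le> T\<close> s(1) T by (auto simp: S_def mono_on_def)
    moreover have "e * (s - a) \<le> e * (T - a)" using \<open>e > 0\<close> \<open>s \<le> T\<close> by simp
    ultimately show "g T - g a \<le> e * (T - a) + (V T - V a) + d" using s(1) by (auto simp: S_def)
  qed
  moreover have "T = b"
  proof (rule ccontr)
    assume "T \<noteq> b"
    then obtain h where h: "h > 0" "T + h \<le> b" "g (T + h) - g T \<le> e * h + (V (T + h) - V T)"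
      using step[of T e] T \<open>e > 0\<close> by auto
    then have "T + h \<in> S" using calculation T by (auto simp: S_def algebra_simps)
    then show False using cSup_upper[OF _ bdd, of "T + h"] h(1) by (simp add: T_def)
  qed
  moreover have "e * (b - a) \<le> e0" using \<open>e0 > 0\<close> \<open>a \<le> b\<close> by (simp add: e_def field_simps)
  ultimately show "g b - g a \<le> V b - V a + e0" by simp
qed

lemma abs_continuous_on_imp_continuous_on:
  assumes "abs_continuous_on a b x"
  shows "continuous_on {a..b} x"
  unfolding continuous_on_iff
proof (intro ballI allI impI)
  fix s e :: real assume s: "s \<in> {a..b}" and "e > 0"
  then obtain d where "d > 0" and d: "\<And>(m::nat) u v.
        (\<forall>k<m. a \<le> u k \<and> u k \<le> v k \<and> v k \<le> b) \<and>
        disjoint_family_on (\<lambda>k. {u k<..<v k}) {..<m} \<and>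
        (\<Sum>k<m. v k - u k) < d \<Longrightarrow> (\<Sum>k<m. norm (x (v k) - x (u k))) < e"
    using assms unfolding abs_continuous_on_def by blast
  have "dist (x t) (x s) < e" if "t \<in> {a..b}" "dist t s < d" for t
    using d[of 1 "\<lambda>_. min s t" "\<lambda>_. max s t"] that s
    by (cases "s \<le> t")
       (auto simp: disjoint_family_on_def dist_norm norm_minus_commute min_def max_def
         split: if_splits)
  then show "\<exists>d>0. \<forall>x'\<in>{a..b}. dist x' s < d \<longrightarrow> dist (x x') (x s) < e"
    using \<open>d > 0\<close> by blast
qed

text \<open>Absolute continuity makes the null set \<open>Z\<close> harmless: it lies in an open set
  \<open>G\<close> of measure so small that \<open>g\<close> varies by less than \<open>e\<close>
  over disjoint intervals inside \<open>G\<close>. Steps from outside \<open>Z\<close> are given,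
  and steps from points of \<open>Z\<close> can be kept inside \<open>G\<close>.\<close>

lemma abs_continuous_nonincreasing:
  fixes g :: "real \<Rightarrow> real"
  assumes "a \<le> b" and ac: "abs_continuous_on a b g" and Z: "negligible Z"
    and step: "\<And>t e. a \<le> t \<Longrightarrow> t < b \<Longrightarrow> t \<notin> Z \<Longrightarrow> e > 0 \<Longrightarrow>
      \<exists>h>0. t + h \<le> b \<and> g (t + h) - g t \<le> e * h"
  shows "g b \<le> g a"
proof (rule field_le_epsilon)
  fix e :: real assume "e > 0"
  then obtain d where "d > 0" and d: "\<And>(m::nat) u v.
        (\<forall>k<m. a \<le> u k \<and> u k \<le> v k \<and> v k \<le> b) \<Longrightarrow>
        disjoint_family_on (\<lambda>k. {u k<..<v k}) {..<m} \<Longrightarrow>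
        (\<Sum>k<m. v k - u k) < d \<Longrightarrow> (\<Sum>k<m. norm (g (v k) - g (u k))) < e"
    using ac unfolding abs_continuous_on_def by meson
  obtain G where G: "open G" "Z \<subseteq> G" "G \<in> lmeasurable" "measure lebesgue G < d"
  proof -
    have Z0: "Z \<in> lmeasurable" "measure lebesgue Z = 0"
      using Z by (auto simp: negligible_iff_measure)
    have "Z \<in> sets lebesgue" using Z0(1) by (rule fmeasurableD)
    then obtain G where G: "open G" "Z \<subseteq> G" "G - Z \<in> lmeasurable"
      "emeasure lebesgue (G - Z) < ennreal d"
      using sets_lebesgue_outer_open[OF _ \<open>d > 0\<close>] by blast
    have eq: "G = Z \<union> (G - Z)" using G by auto
    have GZ: "measure lebesgue (G - Z) < d"
      using G \<open>d > 0\<close> by (simp add: emeasure_eq_measure2 ennreal_less_iff)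
    have "G \<in> lmeasurable" using fmeasurable.Un[OF Z0(1) G(3)] eq by simp
    moreover have "measure lebesgue G < d"
      using measure_Un_le[of Z lebesgue "G - Z"] Z0 G(3) GZ eq by (simp add: fmeasurableD)
    ultimately show ?thesis using that G by blast
  qed
  define P where "P s (m::nat) u v \<longleftrightarrow>
    (\<forall>k<m. a \<le> u k \<and> u k \<le> v k \<and> v k \<le> s \<and> {u k<..<v k} \<subseteq> G) \<and>
    disjoint_family_on (\<lambda>k. {u k<..<v k}) {..<m}" for s m and u v :: "nat \<Rightarrow> real"
  \<comment> \<open>\<open>V s\<close> is the variation of \<open>g\<close> over the part of \<open>G\<close> between \<open>a\<close> and \<open>s\<close>; it pays for the
    increments of \<open>g\<close> at points of \<open>Z\<close>.\<close>
  define W where "W s = {w. \<exists>m u v. P s m u v \<and> w = (\<Sum>k<m. \<bar>g (v k) - g (u k)\<bar>)}" for s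
  define V where "V s = Sup (W s)" for s
  have W_less: "w < e" if "w \<in> W s" "s \<le> b" for w s
  proof -
    obtain m u v where P: "P s m u v" and w: "w = (\<Sum>k<m. \<bar>g (v k) - g (u k)\<bar>)"
      using \<open>w \<in> W s\<close> unfolding W_def by auto
    have "(\<Sum>k<m. v k - u k) = (\<Sum>k<m. measure lebesgue {u k<..<v k})"
      using P by (intro sum.cong) (auto simp: P_def)
    also have "\<dots> = measure lebesgue (\<Union>k<m. {u k<..<v k})"
      using P by (intro measure_finite_Union[symmetric]) (auto simp: P_def emeasure_lborel_Ioo)
    also have "\<dots> \<le> measure lebesgue G"
      using P G by (intro measure_mono_fmeasurable) (auto simp: P_def)
    finally show ?thesis
      using d[of m u v] P G(4) \<open>s \<le> b\<close> unfolding w by (force simp: P_def)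
  qed
  have bdd: "bdd_above (W s)" if "s \<le> b" for s
    using W_less[OF _ that] by (meson bdd_aboveI less_imp_le)
  have W0: "0 \<in> W s" for s
    unfolding W_def P_def by (auto simp: disjoint_family_on_def intro!: exI[of _ "0::nat"])
  have W_mono: "W s \<subseteq> W t" if "s \<le> t" for s t
  proof -
    have "P t m u v" if "P s m u v" for m u v
      using that \<open>s \<le> t\<close> unfolding P_def by fastforce
    then show ?thesis unfolding W_def by blast
  qed
  have V_mono: "V s \<le> V t" if "s \<le> t" "t \<le> b" for s t
    unfolding V_def using W0[of s] by (intro cSup_subset_mono bdd W_mono that) auto
  have "g b - g a \<le> V b - V a"
  proof (rule growth_le_by_right_steps)
    show "continuous_on {a..b} g" by (rule abs_continuous_on_imp_continuous_on[OF ac])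
    show "mono_on {a..b} V"
      using V_mono by (auto intro: mono_onI)
    fix t e' :: real assume t: "a \<le> t" "t < b" and e': "e' > 0"
    show "\<exists>h>0. t + h \<le> b \<and> g (t + h) - g t \<le> e' * h + (V (t + h) - V t)"
    proof (cases "t \<in> Z")
      case False
      then obtain h where h: "h > 0" "t + h \<le> b" "g (t + h) - g t \<le> e' * h"
        using step[OF t _ e'] by blast
      have "V t \<le> V (t + h)"
        using h by (intro V_mono) auto
      then show ?thesis using h by fastforce
    next
      case True
      then obtain r where r: "r > 0" "ball t r \<subseteq> G" using G openE by blast
      define h where "h = min r (b - t)"
      have h: "h > 0" "t + h \<le> b" using r t by (auto simp: h_def)
      have hG: "{t<..<t + h} \<subseteq> G" using r(2) by (force simp: h_def dist_real_def)
      have "V t \<le> V (t + h) - \<bar>g (t + h) - g t\<bar>"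
        unfolding V_def[of t]
      proof (rule cSup_least)
        fix w assume "w \<in> W t"
        then obtain m u v where P: "P t m u v" and w: "w = (\<Sum>k<m. \<bar>g (v k) - g (u k)\<bar>)"
          unfolding W_def by auto
        \<comment> \<open>Appending the interval from \<open>t\<close> to \<open>t + h\<close> to
          any family of intervals up to \<open>t\<close> gives a family up to \<open>t + h\<close>,
          so over this step \<open>V\<close> grows by at least the increment of
          \<open>g\<close>.\<close>
        let ?u = "u(m := t)" and ?v = "v(m := t + h)"
        have "a \<le> ?u k \<and> ?u k \<le> ?v k \<and> ?v k \<le> t + h \<and> {?u k<..<?v k} \<subseteq> G"
          if "k < Suc m" for k
        proof (cases "k = m")
          case False
          then have "a \<le> u k \<and> u k \<le> v k \<and> v k \<le> t \<and> {u k<..<v k} \<subseteq> G"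
            using P that by (simp add: P_def)
          then show ?thesis using False h(1) by simp
        qed (use h t hG in simp)
        moreover have "disjoint_family_on (\<lambda>k. {?u k<..<?v k}) {..<Suc m}"
          unfolding disjoint_family_on_def
        proof (intro ballI impI)
          fix i j assume ij: "i \<in> {..<Suc m}" "j \<in> {..<Suc m}" "i \<noteq> j"
          have new: "{u k<..<v k} \<inter> {t<..<t + h} = {}" if "k < m" for k
            using P that by (force simp: P_def)
          have old: "{u i<..<v i} \<inter> {u j<..<v j} = {}" if "i < m" "j < m"
            using P that ij(3) by (simp add: P_def disjoint_family_on_def)
          show "{?u i<..<?v i} \<inter> {?u j<..<?v j} = {}"
            using ij new[of i] new[of j] old by (cases "i = m"; cases "j = m") (simp_all add: Int_commute)
        qed
        ultimately have "P (t + h) (Suc m) ?u ?v" unfolding P_def by blast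
        moreover have "w + \<bar>g (t + h) - g t\<bar> = (\<Sum>k<Suc m. \<bar>g (?v k) - g (?u k)\<bar>)"
          by (simp add: w)
        ultimately have "w + \<bar>g (t + h) - g t\<bar> \<in> W (t + h)"
          unfolding W_def by blast
        then show "w \<le> V (t + h) - \<bar>g (t + h) - g t\<bar>"
          unfolding V_def using cSup_upper[OF _ bdd[OF h(2)]] by fastforce
      qed (use W0 in auto)
      moreover have "0 \<le> e' * h" using e' h(1) by simp
      ultimately have "g (t + h) - g t \<le> e' * h + (V (t + h) - V t)" by linarith
      then show ?thesis using h by blast
    qed
  qed (use \<open>a \<le> b\<close> in auto)
  moreover have "V b \<le> e" unfolding V_def using W0 W_less by (intro cSup_least) (auto intro: less_imp_le)
  moreover have "0 \<le> V a" unfolding V_def using cSup_upper[OF W0 bdd] \<open>a \<le> b\<close> by auto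
  ultimately show "g b \<le> g a + e" by simp
qed

section \<open>Mean value estimates in a general norm\<close>

lemma has_vector_derivative_is_norm_le:
  fixes f :: "real \<Rightarrow> 'a::euclidean_space"
  assumes N: "is_norm N" and f: "(f has_vector_derivative D) (at r within S)" and "e > 0"
  shows "\<exists>d>0. \<forall>s\<in>S. \<bar>s - r\<bar> < d \<longrightarrow> N (f s - f r - (s - r) *\<^sub>R D) \<le> e * \<bar>s - r\<bar>"
proof -
  obtain M where M: "M > 0" "\<And>x. N x \<le> M * norm x" using is_norm_le_norm[OF N] by blast
  have "e / M > 0" using \<open>e > 0\<close> M by simp
  then obtain d where "d > 0"
    and d: "\<And>s. s \<in> S \<Longrightarrow> norm (s - r) < d \<Longrightarrow>
      norm (f s - f r - (s - r) *\<^sub>R D) \<le> e / M * norm (s - r)"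
    using f unfolding has_vector_derivative_def has_derivative_within_alt by blast
  have "N (f s - f r - (s - r) *\<^sub>R D) \<le> e * \<bar>s - r\<bar>" if "s \<in> S" "\<bar>s - r\<bar> < d" for s
  proof -
    have "N (f s - f r - (s - r) *\<^sub>R D) \<le> M * (e / M * \<bar>s - r\<bar>)"
      using M(2)[of "f s - f r - (s - r) *\<^sub>R D"] mult_left_mono[OF d[of s], of M] that M(1)
      by simp
    then show ?thesis using M(1) by simp
  qed
  then show ?thesis using \<open>d > 0\<close> by blast
qed

text \<open>Only a pointwise bound on the local dilation is assumed, no derivative. In this form the
  estimate applies to the state at a fixed time as a function of a parameter of the initial value,
  whose differentiability is not known.\<close>

lemma is_norm_path_diff_le:
  fixes \<psi> :: "real \<Rightarrow> 'a::euclidean_space"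
  assumes N: "is_norm N" and "a \<le> b" "0 \<le> L"
    and loc: "\<And>r e. a \<le> r \<Longrightarrow> r \<le> b \<Longrightarrow> e > 0 \<Longrightarrow>
      \<exists>d>0. \<forall>s\<in>{a..b}. \<bar>s - r\<bar> < d \<longrightarrow> N (\<psi> s - \<psi> r) \<le> (L + e) * \<bar>s - r\<bar>"
  shows "N (\<psi> b - \<psi> a) \<le> L * (b - a)"
proof -
  have step: "N (\<psi> s - \<psi> a) - N (\<psi> r - \<psi> a) \<le> N (\<psi> s - \<psi> r)" for r s
    using is_norm_diff_triangle[OF N, of "\<psi> s" "\<psi> a" "\<psi> r"] by simp
  \<comment> \<open>The growth lemma is applied with the comparison function
    \<open>V r = L * r\<close>.\<close>
  have "N (\<psi> b - \<psi> a) - N (\<psi> a - \<psi> a) \<le> L * b - L * a"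
  proof (rule growth_le_by_right_steps)
    show "continuous_on {a..b} (\<lambda>r. N (\<psi> r - \<psi> a))"
      unfolding continuous_on_iff
    proof (intro ballI allI impI)
      fix r e :: real assume r: "r \<in> {a..b}" and "e > 0"
      obtain d where "d > 0" and
        d: "\<And>s. s \<in> {a..b} \<Longrightarrow> \<bar>s - r\<bar> < d \<Longrightarrow> N (\<psi> s - \<psi> r) \<le> (L + 1) * \<bar>s - r\<bar>"
        using loc[of r 1] r by auto
      have "dist (N (\<psi> s - \<psi> a)) (N (\<psi> r - \<psi> a)) < e"
        if "s \<in> {a..b}" "dist s r < min d (e / (L + 1))" for s
      proof -
        have "\<bar>N (\<psi> s - \<psi> a) - N (\<psi> r - \<psi> a)\<bar> \<le> N (\<psi> s - \<psi> r)"
          using is_norm_abs_diff[OF N, of "\<psi> s - \<psi> a" "\<psi> r - \<psi> a"] by simp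
        also have "\<dots> \<le> (L + 1) * \<bar>s - r\<bar>" using d that by (simp add: dist_real_def)
        also have "\<dots> < e" using that \<open>0 \<le> L\<close> by (simp add: dist_real_def field_simps)
        finally show ?thesis by (simp add: dist_real_def)
      qed
      then show "\<exists>d>0. \<forall>s\<in>{a..b}. dist s r < d \<longrightarrow>
          dist (N (\<psi> s - \<psi> a)) (N (\<psi> r - \<psi> a)) < e"
        using \<open>d > 0\<close> \<open>e > 0\<close> \<open>0 \<le> L\<close> by (intro exI[of _ "min d (e / (L + 1))"]) auto
    qed
    show "mono_on {a..b} (\<lambda>r. L * r)"
      using \<open>0 \<le> L\<close> by (auto intro!: mono_onI mult_left_mono)
    fix t e :: real assume t: "a \<le> t" "t < b" and "e > 0"
    obtain d where "d > 0" and
      d: "\<And>s. s \<in> {a..b} \<Longrightarrow> \<bar>s - t\<bar> < d \<Longrightarrow> N (\<psi> s - \<psi> t) \<le> (L + e) * \<bar>s - t\<bar>"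
      using loc[of t e] t \<open>e > 0\<close> by auto
    define h where "h = min (d / 2) (b - t)"
    have h: "h > 0" "t + h \<le> b" "h < d" using \<open>d > 0\<close> t by (auto simp: h_def)
    then have "N (\<psi> (t + h) - \<psi> t) \<le> (L + e) * h" using d[of "t + h"] t by simp
    then have "N (\<psi> (t + h) - \<psi> a) - N (\<psi> t - \<psi> a) \<le> e * h + (L * (t + h) - L * t)"
      using step[of "t + h" t] by (simp add: algebra_simps)
    then show "\<exists>h>0. t + h \<le> b \<and> N (\<psi> (t + h) - \<psi> a) - N (\<psi> t - \<psi> a)
        \<le> e * h + (L * (t + h) - L * t)" using h by blast
  qed (use \<open>a \<le> b\<close> in auto)
  then show ?thesis by (simp add: is_norm_zero[OF N] algebra_simps)
qed

text \<open>The bound keeps the constant \<open>L\<close> for the norm \<open>N\<close> itself;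
  passing through the Euclidean norm would cost a factor and destroy contraction rates.\<close>

lemma is_norm_mean_value:
  fixes \<psi> :: "real \<Rightarrow> 'a::euclidean_space"
  assumes N: "is_norm N" and "a \<le> b"
    and deriv: "\<And>r. r \<in> {a..b} \<Longrightarrow> (\<psi> has_vector_derivative \<psi>' r) (at r within {a..b})"
    and bound: "\<And>r. r \<in> {a..b} \<Longrightarrow> N (\<psi>' r) \<le> L"
  shows "N (\<psi> b - \<psi> a) \<le> L * (b - a)"
proof (rule is_norm_path_diff_le[OF N \<open>a \<le> b\<close>])
  show "0 \<le> L" using bound[of a] is_norm_nonneg[OF N, of "\<psi>' a"] \<open>a \<le> b\<close> by simp
  fix r e :: real assume r: "a \<le> r" "r \<le> b" and "e > 0"
  obtain d where "d > 0" and d: "\<And>s. s \<in> {a..b} \<Longrightarrow> \<bar>s - r\<bar> < d \<Longrightarrow>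
      N (\<psi> s - \<psi> r - (s - r) *\<^sub>R \<psi>' r) \<le> e * \<bar>s - r\<bar>"
    using has_vector_derivative_is_norm_le[OF N deriv[of r] \<open>e > 0\<close>] r by auto
  have "N (\<psi> s - \<psi> r) \<le> (L + e) * \<bar>s - r\<bar>" if "s \<in> {a..b}" "\<bar>s - r\<bar> < d" for s
  proof -
    have "N (\<psi> s - \<psi> r) \<le> N ((s - r) *\<^sub>R \<psi>' r) + e * \<bar>s - r\<bar>"
      using is_norm_triangle_sub[OF N, of "\<psi> s - \<psi> r" "(s - r) *\<^sub>R \<psi>' r"] d[OF that] by simp
    also have "\<dots> \<le> \<bar>s - r\<bar> * L + e * \<bar>s - r\<bar>"
      using bound[of r] r by (simp add: is_norm_scaleR[OF N] mult_left_mono)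
    finally show ?thesis by (simp add: algebra_simps)
  qed
  then show "\<exists>d>0. \<forall>s\<in>{a..b}. \<bar>s - r\<bar> < d \<longrightarrow> N (\<psi> s - \<psi> r) \<le> (L + e) * \<bar>s - r\<bar>"
    using \<open>d > 0\<close> by blast
qed

text \<open>Serves to transfer absolute continuity from two solutions to their exponentially
  weighted distance; the term \<open>t - s\<close> accounts for the weight.\<close>

lemma abs_continuous_on_dominated:
  fixes g :: "real \<Rightarrow> real"
  assumes x: "abs_continuous_on a b x" and y: "abs_continuous_on a b y" and "L > 0"
    and g: "\<And>s t. a \<le> s \<Longrightarrow> s \<le> t \<Longrightarrow> t \<le> b \<Longrightarrow>
      \<bar>g t - g s\<bar> \<le> L * (norm (x t - x s) + norm (y t - y s) + (t - s))"
  shows "abs_continuous_on a b g"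
  unfolding abs_continuous_on_def
proof (intro allI impI)
  fix e :: real assume "e > 0"
  \<comment> \<open>One third for each of the variations of \<open>x\<close>, of \<open>y\<close>
    and of time, all multiplied by \<open>L\<close>.\<close>
  define e' where "e' = e / (3 * L)"
  have "e' > 0" using \<open>e > 0\<close> \<open>L > 0\<close> by (simp add: e'_def)
  define Q where "Q m u v \<longleftrightarrow> (\<forall>k<m. a \<le> u k \<and> u k \<le> v k \<and> v k \<le> b) \<and>
    disjoint_family_on (\<lambda>k. {u k<..<v k}) {..<m}" for m :: nat and u v :: "nat \<Rightarrow> real"
  obtain dx where "dx > 0" and dx: "\<And>m u v. Q m u v \<Longrightarrow> (\<Sum>k<m. v k - u k) < dx \<Longrightarrow>
      (\<Sum>k<m. norm (x (v k) - x (u k))) < e'"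
    using x \<open>e' > 0\<close> unfolding abs_continuous_on_def Q_def by meson
  obtain dy where "dy > 0" and dy: "\<And>m u v. Q m u v \<Longrightarrow> (\<Sum>k<m. v k - u k) < dy \<Longrightarrow>
      (\<Sum>k<m. norm (y (v k) - y (u k))) < e'"
    using y \<open>e' > 0\<close> unfolding abs_continuous_on_def Q_def by meson
  have "(\<Sum>k<m. norm (g (v k) - g (u k))) < e"
    if Q: "Q m u v" and small: "(\<Sum>k<m. v k - u k) < Min {dx, dy, e'}" for m u v
  proof -
    have "(\<Sum>k<m. norm (g (v k) - g (u k)))
        \<le> (\<Sum>k<m. L * (norm (x (v k) - x (u k)) + norm (y (v k) - y (u k)) + (v k - u k)))"
      using Q by (intro sum_mono) (auto simp: Q_def intro!: g)
    also have "\<dots> = L * ((\<Sum>k<m. norm (x (v k) - x (u k))) + (\<Sum>k<m. norm (y (v k) - y (u k)))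
        + (\<Sum>k<m. v k - u k))"
      by (simp add: sum_distrib_left sum.distrib distrib_left)
    also have "\<dots> < L * (e' + e' + e')"
      using dx[OF Q] dy[OF Q] small \<open>L > 0\<close> by (intro mult_strict_left_mono add_strict_mono) auto
    also have "\<dots> = e" using \<open>L > 0\<close> by (simp add: e'_def)
    finally show ?thesis .
  qed
  then show "\<exists>\<delta>>0. \<forall>(m::nat) u v.
        (\<forall>k<m. a \<le> u k \<and> u k \<le> v k \<and> v k \<le> b) \<and>
        disjoint_family_on (\<lambda>k. {u k<..<v k}) {..<m} \<and>
        (\<Sum>k<m. v k - u k) < \<delta>
        \<longrightarrow> (\<Sum>k<m. norm (g (v k) - g (u k))) < e"
    using \<open>dx > 0\<close> \<open>dy > 0\<close> \<open>e' > 0\<close>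
    by (intro exI[of _ "Min {dx, dy, e'}"]) (auto simp: Q_def)
qed

subsection \<open>Matrix measures\<close>

lemma is_norm_matrix_bounded:
  fixes A :: "real^'n^'n"
  assumes N: "is_norm N"
  shows "\<exists>M. \<forall>x. N (A *v x) \<le> M * N x"
proof -
  obtain M1 where M1: "M1 > 0" "\<And>x. N x \<le> M1 * norm x" using is_norm_le_norm[OF N] by blast
  obtain M2 where M2: "M2 > 0" "\<And>x. norm x \<le> M2 * N x" using is_norm_ge_norm[OF N] by blast
  obtain B where B: "B > 0" "\<And>x. norm (A *v x) \<le> norm x * B"
    using bounded_linear.pos_bounded[OF matrix_vector_mul_bounded_linear[of A]] by blast
  have "N (A *v x) \<le> M1 * (M2 * B) * N x" for x
  proof -
    have "N (A *v x) \<le> M1 * norm (A *v x)" by (rule M1)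
    also have "\<dots> \<le> M1 * (norm x * B)" using M1 B by (intro mult_left_mono) auto
    also have "\<dots> \<le> M1 * (M2 * N x * B)"
      using M1(1) M2(2) B(1) by (intro mult_left_mono mult_right_mono) auto
    finally show ?thesis by (simp add: algebra_simps)
  qed
  then show ?thesis by blast
qed

lemma is_norm_unit_exists:
  assumes N: "is_norm (N :: real^'n \<Rightarrow> real)"
  shows "{x. N x = 1} \<noteq> {}"
proof -
  define e :: "real^'n" where "e = axis undefined 1"
  have "e \<noteq> 0" by (simp add: e_def axis_eq_0_iff)
  then have "N e > 0" using is_norm_nonneg[OF N, of e] is_norm_eq_0_iff[OF N, of e] by simp
  then have "N ((1 / N e) *\<^sub>R e) = 1" by (simp add: is_norm_scaleR[OF N])
  then show ?thesis by blast
qed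

lemma induced_norm_bound:
  assumes N: "is_norm (N :: real^'n \<Rightarrow> real)"
  shows "N (A *v x) \<le> induced_norm N A * N x"
proof (cases "x = 0")
  case False
  then have pos: "N x > 0" using is_norm_nonneg[OF N, of x] is_norm_eq_0_iff[OF N, of x] by simp
  obtain M where "\<And>x. N (A *v x) \<le> M * N x" using is_norm_matrix_bounded[OF N] by blast
  then have "bdd_above ((\<lambda>x. N (A *v x)) ` {x. N x = 1})"
    by (intro bdd_aboveI[of _ M]) (metis (mono_tags) imageE mem_Collect_eq mult.right_neutral)
  then have "N (A *v ((1 / N x) *\<^sub>R x)) \<le> induced_norm N A"
    unfolding induced_norm_def using pos by (intro cSUP_upper) (auto simp: is_norm_scaleR[OF N])
  then show ?thesis
    using pos by (simp add: matrix_vector_mult_scaleR is_norm_scaleR[OF N] field_simps)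
qed (simp add: is_norm_zero[OF N])

lemma induced_norm_least:
  assumes N: "is_norm (N :: real^'n \<Rightarrow> real)" and "\<And>x. N (A *v x) \<le> L * N x"
  shows "induced_norm N A \<le> L"
  unfolding induced_norm_def using assms(2)
  by (intro cSUP_least is_norm_unit_exists[OF N]) (metis mem_Collect_eq mult.right_neutral)

lemma mat_1_plus_scaleR_mult: "(mat 1 + h *\<^sub>R A) *v x = x + h *\<^sub>R (A *v x)"
  for A :: "real^'n^'n"
  by (simp add: matrix_vector_mult_add_rdistrib scaleR_matrix_vector_assoc)

text \<open>By convexity of the norm the difference quotient \<open>q h\<close> is nondecreasing in
  \<open>h\<close>, and it is bounded below. Hence the limit defining the matrix measure exists, as
  the infimum of \<open>q\<close>, and a bound on it yields a bound for all small steps, uniformly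
  in \<open>x\<close>.\<close>

lemma matrix_measure_le_imp:
  assumes N: "is_norm (N :: real^'n \<Rightarrow> real)" and A: "matrix_measure N A \<le> c" and "e > 0"
  shows "\<exists>k>0. \<forall>h x. 0 < h \<longrightarrow> h < k \<longrightarrow> N (x + h *\<^sub>R (A *v x)) \<le> (1 + h * (c + e)) * N x"
proof -
  define q where "q h = (induced_norm N (mat 1 + h *\<^sub>R A) - 1) / h" for h
  have bound: "N (x + h *\<^sub>R (A *v x)) \<le> induced_norm N (mat 1 + h *\<^sub>R A) * N x" for h x
    using induced_norm_bound[OF N, of "mat 1 + h *\<^sub>R A" x] by (simp add: mat_1_plus_scaleR_mult)
  have mono: "q h \<le> q k" if "0 < h" "h \<le> k" for h k
  proof -
    let ?k = "induced_norm N (mat 1 + k *\<^sub>R A)"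
    \<comment> \<open>\<open>mat 1 + h A\<close> is the convex combination of \<open>mat 1\<close>
      and \<open>mat 1 + k A\<close> with weights \<open>1 - h / k\<close> and
      \<open>h / k\<close>.\<close>
    have "induced_norm N (mat 1 + h *\<^sub>R A) \<le> (1 - h / k) + (h / k) * ?k"
    proof (rule induced_norm_least[OF N])
      fix x
      have "x + h *\<^sub>R (A *v x) = (1 - h / k) *\<^sub>R x + (h / k) *\<^sub>R (x + k *\<^sub>R (A *v x))"
        using that by (simp add: algebra_simps)
      then have "N (x + h *\<^sub>R (A *v x)) \<le> (1 - h / k) * N x + (h / k) * N (x + k *\<^sub>R (A *v x))"
        using is_norm_triangle[OF N, of "(1 - h / k) *\<^sub>R x" "(h / k) *\<^sub>R (x + k *\<^sub>R (A *v x))"] that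
        by (simp add: is_norm_scaleR[OF N])
      also have "\<dots> \<le> (1 - h / k) * N x + (h / k) * (?k * N x)"
        using that bound by (intro add_left_mono mult_left_mono) auto
      finally show "N ((mat 1 + h *\<^sub>R A) *v x) \<le> ((1 - h / k) + (h / k) * ?k) * N x"
        unfolding mat_1_plus_scaleR_mult by (simp add: algebra_simps del: scaleR_matrix_vector_assoc)
    qed
    then have "(induced_norm N (mat 1 + h *\<^sub>R A) - 1) / h \<le> (h / k * (?k - 1)) / h"
      using that by (intro divide_right_mono) (auto simp: algebra_simps)
    then show ?thesis using that by (simp add: q_def)
  qed
  \<comment> \<open>The reverse triangle inequality at a unit vector; it makes the infimum of
    \<open>q\<close> finite.\<close>
  have lower: "- induced_norm N A \<le> q h" if "0 < h" for h
  proof -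
    obtain x where x: "N x = 1" using is_norm_unit_exists[OF N] by blast
    have "N x \<le> N (x + h *\<^sub>R (A *v x)) + h * N (A *v x)"
      using is_norm_triangle_sub[OF N, of x "x + h *\<^sub>R (A *v x)"] that
      by (simp add: is_norm_minus[OF N] is_norm_scaleR[OF N])
    also have "\<dots> \<le> induced_norm N (mat 1 + h *\<^sub>R A) + h * induced_norm N A"
      using bound[of x h] induced_norm_bound[OF N, of A x] that x
      by (intro add_mono mult_left_mono) auto
    finally show ?thesis using that x by (simp add: q_def field_simps)
  qed
  define L where "L = Inf (q ` {0<..})"
  have bdd: "bdd_below (q ` {0<..})" using lower by (intro bdd_belowI[of _ "- induced_norm N A"]) auto
  have "(q \<longlongrightarrow> L) (at_right 0)"
  proof (rule order_tendstoI)
    fix a assume "a < L"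
    then have "a < q h" if "h > 0" for h
      using cInf_lower[OF _ bdd, of "q h"] that unfolding L_def by fastforce
    then show "eventually (\<lambda>h. a < q h) (at_right 0)"
      unfolding eventually_at_right_field by (intro exI[of _ 1]) simp
  next
    fix a assume "L < a"
    then obtain k where "k > 0" "q k < a"
      using cInf_lessD[of "q ` {0<..}" a] unfolding L_def by auto
    then have "q h < a" if "0 < h" "h < k" for h
      using mono[of h k] that by simp
    then show "eventually (\<lambda>h. q h < a) (at_right 0)"
      using \<open>k > 0\<close> unfolding eventually_at_right_field by blast
  qed
  moreover from this have "L = matrix_measure N A"
    unfolding matrix_measure_def q_def by (intro tendsto_Lim[symmetric]) auto
  ultimately have "eventually (\<lambda>h. q h < c + e) (at_right 0)"
    using A \<open>e > 0\<close> by (intro order_tendstoD) auto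
  then obtain k where k: "k > 0" "\<And>h. 0 < h \<Longrightarrow> h < k \<Longrightarrow> q h < c + e"
    by (auto simp: eventually_at_right_field)
  have "N (x + h *\<^sub>R (A *v x)) \<le> (1 + h * (c + e)) * N x" if "0 < h" "h < k" for h x
  proof -
    have "induced_norm N (mat 1 + h *\<^sub>R A) \<le> 1 + h * (c + e)"
      using k(2)[OF that] that by (simp add: q_def field_simps)
    then have "induced_norm N (mat 1 + h *\<^sub>R A) * N x \<le> (1 + h * (c + e)) * N x"
      by (intro mult_right_mono is_norm_nonneg[OF N])
    then show ?thesis using bound[of x h] by linarith
  qed
  then show ?thesis using k(1) by blast
qed

text \<open>The column and the row are matrices with an unspecified number of equal columns and rows,
  respectively; it enters the product as a factor.\<close>

lemma columnvector_rowvector_mult: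
  fixes u g x :: "real^'n"
  shows "((columnvector u :: real^'m^'n) ** (rowvector g :: real^'n^'m)) *v x =
    ((real CARD('m) *\<^sub>R g) \<bullet> x) *\<^sub>R u"
  by (simp add: vec_eq_iff matrix_vector_mult_def matrix_matrix_mult_def columnvector_def
      rowvector_def inner_vec_def sum_distrib_right sum_distrib_left mult_ac)

text \<open>Zero measure says that, in the half-space where \<open>g\<close> has positive inner
  product with the point, moving in direction \<open>u\<close> does not increase the norm to first
  order. If \<open>g \<bullet> u < 0\<close>, the path from \<open>W - a u\<close> to
  \<open>W\<close> stays in that half-space until its end. Otherwise the ray from \<open>g\<close>
  in direction \<open>u\<close> never leaves it, and a bounded norm on that ray forces
  \<open>u = 0\<close>.\<close>

lemma rank_one_measure_zero:
  fixes N :: "real^'n \<Rightarrow> real"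
  assumes N: "is_norm N" and mm: "matrix_measure N A = 0"
    and A: "\<And>x. A *v x = (g \<bullet> x) *\<^sub>R u"
    and "g \<noteq> 0" and W: "g \<bullet> W \<ge> 0" and "a \<ge> 0"
  shows "N W \<le> N (W - a *\<^sub>R u)"
proof -
  \<comment> \<open>The matrix acts at \<open>w\<close> as a positive multiple of \<open>u\<close> as long as \<open>g \<bullet> w > 0\<close>.\<close>
  have descend: "N (w + \<alpha> *\<^sub>R u) \<le> N w"
    if "\<alpha> \<ge> 0" and pos: "\<And>s. 0 \<le> s \<Longrightarrow> s < \<alpha> \<Longrightarrow> g \<bullet> (w + s *\<^sub>R u) > 0" for w \<alpha>
  proof -
    have "N (w + \<alpha> *\<^sub>R u) - N (w + 0 *\<^sub>R u) \<le> (0::real) - 0"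
    proof (rule growth_le_by_right_steps[OF \<open>\<alpha> \<ge> 0\<close>, where V = "\<lambda>_. 0"])
      show "continuous_on {0..\<alpha>} (\<lambda>s. N (w + s *\<^sub>R u))"
        by (intro continuous_on_compose2[OF is_norm_continuous_on[OF N]] continuous_intros) auto
      fix t e :: real assume t: "0 \<le> t" "t < \<alpha>" and "e > 0"
      define v where "v = w + t *\<^sub>R u"
      have v: "g \<bullet> v > 0" using pos t by (simp add: v_def)
      have "N v + 1 > 0" using is_norm_nonneg[OF N, of v] by simp
      \<comment> \<open>A matrix step of length \<open>h\<close> from \<open>v\<close> advances the
        parameter by \<open>h * (g \<bullet> v)\<close>. With this \<open>e'\<close> the error
        \<open>h * e' * N v\<close> is at most \<open>e\<close> times that advance.\<close>
      define e' where "e' = e * (g \<bullet> v) / (N v + 1)"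
      have "e' > 0" using v \<open>e > 0\<close> \<open>N v + 1 > 0\<close> by (simp add: e'_def)
      then obtain k where k: "k > 0" "\<And>h. 0 < h \<Longrightarrow> h < k \<Longrightarrow>
          N (v + h *\<^sub>R ((g \<bullet> v) *\<^sub>R u)) \<le> (1 + h * e') * N v"
        using matrix_measure_le_imp[OF N order_eq_refl[OF mm], of e']
        by (auto simp: A)
      define h where "h = min (k / 2) ((\<alpha> - t) / (g \<bullet> v))"
      have h: "0 < h" "h < k" "h * (g \<bullet> v) \<le> \<alpha> - t"
        using k(1) t v by (auto simp: h_def min_def field_simps)
      have "e' * N v \<le> e * (g \<bullet> v)"
        using \<open>e > 0\<close> v is_norm_nonneg[OF N, of v] by (simp add: e'_def field_simps)
      then have "h * (e' * N v) \<le> h * (e * (g \<bullet> v))" using h(1) by (intro mult_left_mono) auto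
      then have "N (v + (h * (g \<bullet> v)) *\<^sub>R u) - N v \<le> e * (h * (g \<bullet> v))"
        using k(2)[OF h(1,2)] by (simp add: algebra_simps)
      then show "\<exists>h>0. t + h \<le> \<alpha> \<and>
          N (w + (t + h) *\<^sub>R u) - N (w + t *\<^sub>R u) \<le> e * h + (0 - 0)"
        using h v mult_pos_pos[OF h(1) v]
        by (intro exI[of _ "h * (g \<bullet> v)"]) (simp add: v_def scaleR_add_left add.assoc)
    qed (auto intro: mono_onI)
    then show ?thesis by simp
  qed
  show ?thesis
  proof (cases "g \<bullet> u < 0")
    case True
    \<comment> \<open>Strictness is lost only at the endpoint \<open>s = a\<close>, where the value
      is \<open>g \<bullet> W\<close>; \<open>descend\<close> asks for positivity before the
      endpoint only.\<close>
    have "g \<bullet> (W - a *\<^sub>R u + s *\<^sub>R u) > 0" if "0 \<le> s" "s < a" for s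
    proof -
      have "(a - s) * (g \<bullet> u) < 0" using that True by (simp add: mult_pos_neg)
      then show ?thesis using W by (simp add: inner_diff_right inner_add_right algebra_simps)
    qed
    then show ?thesis using descend[OF \<open>a \<ge> 0\<close>, of "W - a *\<^sub>R u"] by simp
  next
    case False
    have gg: "g \<bullet> g > 0" using \<open>g \<noteq> 0\<close> by simp
    have le: "\<alpha> * N u \<le> 2 * N g" if "\<alpha> \<ge> 0" for \<alpha>
    proof -
      have "g \<bullet> (g + s *\<^sub>R u) > 0" if "0 \<le> s" for s
        using gg False that by (simp add: inner_add_right add_pos_nonneg)
      then have "N (g + \<alpha> *\<^sub>R u) \<le> N g" using descend[OF that] by blast
      moreover have "N (\<alpha> *\<^sub>R u) \<le> N (g + \<alpha> *\<^sub>R u) + N g"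
        using is_norm_triangle_sub[OF N, of "\<alpha> *\<^sub>R u" "g + \<alpha> *\<^sub>R u"] by (simp add: is_norm_minus[OF N])
      ultimately show ?thesis using that by (simp add: is_norm_scaleR[OF N])
    qed
    \<comment> \<open>Here the norm would not increase along a whole ray in the direction \<open>u\<close>.\<close>
    have "u = 0"
    proof (rule ccontr)
      assume "u \<noteq> 0"
      then have "N u > 0" using is_norm_nonneg[OF N, of u] is_norm_eq_0_iff[OF N, of u] by simp
      \<comment> \<open>The parameter is chosen so that its product with \<open>N u\<close> is
        \<open>2 * N g + 1\<close>, just beyond the bound \<open>le\<close>.\<close>
      then show False
        using le[of "(2 * N g + 1) / N u"] is_norm_nonneg[OF N, of g] by simp
    qed
    then show ?thesis by simp
  qed
qed

text \<open>The mean value estimate is applied to the Euler map sending \<open>z\<close> to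
  \<open>z + h f(z)\<close> along the segment from \<open>y\<close> to \<open>x\<close>. Its
  derivative is a small perturbation of the one at \<open>p\<close>, by continuity of the Jacobian,
  and the gap between \<open>c'\<close> and \<open>c\<close> absorbs the perturbation.\<close>

lemma measure_contraction:
  fixes f :: "real^'n \<Rightarrow> real^'n"
  assumes "open U" and f: "Ck_on 1 f U" and p: "p \<in> U" and N: "is_norm N"
    and mm: "matrix_measure N (jacobian f (at p)) \<le> - c" and "c' < c"
  shows "\<exists>r>0. \<exists>k>0. ball p r \<subseteq> U \<and> (\<forall>x\<in>ball p r. \<forall>y\<in>ball p r. \<forall>h. 0 < h \<longrightarrow> h < k \<longrightarrow>
      N ((x - y) + h *\<^sub>R (f x - f y)) \<le> (1 - h * c') * N (x - y))"
proof -
  define D where "D z = frechet_derivative f (at z)" for z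
  have fD: "(f has_derivative D z) (at z)" if "z \<in> U" for z
    using f that unfolding D_def by (simp flip: frechet_derivative_works)
  have D_cont: "continuous_on U (\<lambda>z. D z b)" if "b \<in> Basis" for b
    using f that by (simp add: D_def)
  have jac: "jacobian f (at p) *v w = D p w" for w
    using matrix_works[of "D p"] has_derivative_linear[OF fD[OF p]]
    by (simp add: jacobian_def D_def[symmetric])
  \<comment> \<open>Half of the gap pays for the limit in the matrix measure, the other half for the
    variation of the Jacobian over the ball.\<close>
  define e where "e = (c - c') / 2"
  have "e > 0" using \<open>c' < c\<close> by (simp add: e_def)
  obtain k where "k > 0" and k: "\<And>h w. 0 < h \<Longrightarrow> h < k \<Longrightarrow>
      N (w + h *\<^sub>R D p w) \<le> (1 + h * (- c + e)) * N w"
    using matrix_measure_le_imp[OF N mm \<open>e > 0\<close>] unfolding jac by blast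
  obtain M where M: "M > 0" "\<And>x. norm x \<le> M * N x" using is_norm_ge_norm[OF N] by blast
  \<comment> \<open>Continuity of the derivative is known only along basis vectors. This sum is
    continuous, vanishes at \<open>p\<close> and, up to the factor \<open>M\<close>, bounds the
    operator norm of \<open>D z - D p\<close> induced by \<open>N\<close>.\<close>
  define S where "S z = (\<Sum>b\<in>Basis. N (D z b - D p b))" for z
  have "continuous_on U S"
    unfolding S_def
    by (intro continuous_on_sum continuous_on_compose2[OF is_norm_continuous_on[OF N, of UNIV]]
        continuous_on_diff D_cont continuous_on_const) auto
  then have "(S \<longlongrightarrow> S p) (at p)"
    using p \<open>open U\<close> by (simp add: continuous_on_eq_continuous_at continuous_at)
  moreover have Sp: "S p = 0" by (simp add: S_def is_norm_zero[OF N])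
  ultimately have "eventually (\<lambda>z. S z < e / M) (at p)"
    using M \<open>e > 0\<close> by (intro order_tendstoD) auto
  then obtain r1 where r1: "r1 > 0" "\<And>z. dist z p < r1 \<Longrightarrow> S z < e / M"
    using Sp M \<open>e > 0\<close> unfolding eventually_at by (metis UNIV_I divide_pos_pos)
  obtain r2 where r2: "r2 > 0" "ball p r2 \<subseteq> U" using \<open>open U\<close> p openE by blast
  have close: "N (D z w - D p w) \<le> e * N w" if z: "z \<in> U" "dist z p < r1" for z w
  proof -
    have lin: "linear (\<lambda>w. D z w - D p w)"
      using fD z(1) p by (intro linear_compose_sub has_derivative_linear) auto
    have "D z w - D p w = (\<Sum>b\<in>Basis. (w \<bullet> b) *\<^sub>R (D z b - D p b))"
      using linear_sum[OF lin, of "\<lambda>b. (w \<bullet> b) *\<^sub>R b" Basis] linear_scale[OF lin]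
      by (simp add: euclidean_representation)
    also have "N \<dots> \<le> (\<Sum>b\<in>Basis. N ((w \<bullet> b) *\<^sub>R (D z b - D p b)))"
      by (rule is_norm_sum_le[OF N])
    also have "\<dots> \<le> (\<Sum>b\<in>Basis. norm w * N (D z b - D p b))"
      by (intro sum_mono) (auto simp: is_norm_scaleR[OF N] intro!: mult_right_mono
          Basis_le_norm is_norm_nonneg[OF N])
    also have "\<dots> = norm w * S z" by (simp add: S_def sum_distrib_left)
    also have "\<dots> \<le> (M * N w) * (e / M)"
      using M(2)[of w] r1(2)[OF z(2)] \<open>e > 0\<close> M(1) is_norm_nonneg[OF N]
      by (intro mult_mono) (auto simp: S_def intro!: sum_nonneg)
    finally show ?thesis using M(1) by (simp add: mult.commute)
  qed
  define r where "r = min r1 r2"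
  have "N ((x - y) + h *\<^sub>R (f x - f y)) \<le> (1 - h * c') * N (x - y)"
    if xy: "x \<in> ball p r" "y \<in> ball p r" and h: "0 < h" "h < k" for x y h
  proof -
    define w where "w = x - y"
    define \<psi> where "\<psi> s = (y + s *\<^sub>R w) + h *\<^sub>R f (y + s *\<^sub>R w)" for s
    define \<psi>' where "\<psi>' s = w + h *\<^sub>R D (y + s *\<^sub>R w) w" for s
    have z: "y + s *\<^sub>R w \<in> U \<and> dist (y + s *\<^sub>R w) p < r1" if "s \<in> {0..1}" for s
    proof -
      have "y + s *\<^sub>R w = (1 - s) *\<^sub>R y + s *\<^sub>R x" by (simp add: w_def algebra_simps)
      then have "y + s *\<^sub>R w \<in> ball p r"
        using xy that convex_ball[of p r] unfolding convex_alt by auto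
      then show ?thesis using r2 by (auto simp: r_def dist_commute)
    qed
    have "N (\<psi> 1 - \<psi> 0) \<le> ((1 - h * c') * N w) * (1 - 0)"
    proof (rule is_norm_mean_value[OF N, where \<psi>' = \<psi>'])
      fix s :: real assume s: "s \<in> {0..1}"
      have "((\<lambda>s. f (y + s *\<^sub>R w)) has_vector_derivative D (y + s *\<^sub>R w) w) (at s within {0..1})"
      proof -
        have "((\<lambda>s. y + s *\<^sub>R w) has_derivative (\<lambda>s. s *\<^sub>R w)) (at s within {0..1})"
          by (auto intro!: derivative_eq_intros)
        from has_derivative_compose[OF this fD] z[OF s] show ?thesis
          using linear_scale[OF has_derivative_linear[OF fD]] by (simp add: has_vector_derivative_def)
      qed
      then show "(\<psi> has_vector_derivative \<psi>' s) (at s within {0..1})"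
        unfolding \<psi>_def \<psi>'_def by (auto intro!: derivative_eq_intros)
      have "N (\<psi>' s) \<le> N (w + h *\<^sub>R D p w) + N (h *\<^sub>R (D (y + s *\<^sub>R w) w - D p w))"
        using is_norm_triangle[OF N, of "w + h *\<^sub>R D p w" "h *\<^sub>R (D (y + s *\<^sub>R w) w - D p w)"]
        by (simp add: \<psi>'_def algebra_simps)
      also have "\<dots> \<le> (1 + h * (- c + e)) * N w + h * (e * N w)"
        using k[OF h] close[of "y + s *\<^sub>R w" w] z[OF s] h
        by (intro add_mono) (auto simp: is_norm_scaleR[OF N])
      also have "\<dots> = (1 - h * c') * N w" by (simp add: e_def field_simps)
      finally show "N (\<psi>' s) \<le> (1 - h * c') * N w" .
    qed auto
    then show ?thesis by (simp add: \<psi>_def w_def algebra_simps)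
  qed
  moreover have "r > 0" "ball p r \<subseteq> U" using r1 r2 by (auto simp: r_def)
  ultimately show ?thesis using \<open>k > 0\<close> by blast
qed

subsection \<open>Geometry of the switching manifold and Filippov velocities\<close>

text \<open>Suppose the derivative were negative at every zero. Then \<open>\<phi>\<close> is
  positive somewhere: at 1, or just left of 1 if \<open>\<phi> 1 = 0\<close>. The last point before
  it with a nonpositive value is a zero, and a negative derivative there would produce later
  nonpositive values. Continuity of the derivative plays no part in the argument.\<close>

lemma upward_crossing_exists:
  fixes \<phi> :: "real \<Rightarrow> real"
  assumes deriv: "\<And>s. s \<in> {0..1} \<Longrightarrow> (\<phi> has_real_derivative \<phi>' s) (at s within {0..1})"
    and ends: "\<phi> 0 \<le> 0" "\<phi> 1 \<ge> 0"
  shows "\<exists>s\<in>{0..1}. \<phi> s = 0 \<and> \<phi>' s \<ge> 0"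
proof (rule ccontr)
  assume neg: "\<not> ?thesis"
  have "continuous_on {0..1} \<phi>" using deriv by (meson DERIV_continuous_on)
  then have cont: "continuous_on {a..b} \<phi>" if "0 \<le> a" "b \<le> 1" for a b
    using that continuous_on_subset by fastforce
  obtain b where b: "0 \<le> b" "b \<le> 1" "\<phi> b > 0"
  proof (cases "\<phi> 1 = 0")
    case True
    then have "\<phi>' 1 < 0" using neg by force
    then obtain d where "d > 0" "\<And>h. h > 0 \<Longrightarrow> 1 - h \<in> {0..1} \<Longrightarrow> h < d \<Longrightarrow> \<phi> 1 < \<phi> (1 - h)"
      using has_real_derivative_neg_dec_left[OF deriv[of 1]] by auto
    then have "\<phi> 1 < \<phi> (1 - min 1 (d / 2))" by simp
    then show ?thesis using that[of "1 - min 1 (d / 2)"] True \<open>d > 0\<close> by auto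
  next
    case False
    then show ?thesis using that[of 1] ends by simp
  qed
  define S where "S = {s \<in> {0..b}. \<phi> s \<in> {..0}}"
  have "closed S"
    unfolding S_def using cont[of 0 b] b by (intro continuous_closed_preimage[unfolded vimage_def Int_def, simplified]) auto
  moreover have "bounded S" unfolding S_def by (rule bounded_subset[of "{0..b}"]) auto
  ultimately have "compact S" by (simp add: compact_eq_bounded_closed)
  moreover have "S \<noteq> {}" using b ends by (auto simp: S_def)
  ultimately obtain T where T: "T \<in> S" "\<And>s. s \<in> S \<Longrightarrow> s \<le> T"
    by (metis compact_attains_sup)
  have "T \<noteq> b" using T(1) b(3) by (auto simp: S_def)
  then have T': "0 \<le> T" "T < b" "\<phi> T \<le> 0" using T(1) by (auto simp: S_def)
  have "\<exists>s\<ge>T. s \<le> b \<and> \<phi> s = 0"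
    by (rule IVT') (use T' b cont in auto)
  then obtain s where "T \<le> s" "s \<le> b" "\<phi> s = 0" by blast
  then have "\<phi> T = 0" using T(2)[of s] T' by (auto simp: S_def)
  then have "\<phi>' T < 0" using neg T' b by force
  then obtain d where "d > 0" and d: "\<And>h. h > 0 \<Longrightarrow> T + h \<in> {0..1} \<Longrightarrow> h < d \<Longrightarrow> \<phi> (T + h) < \<phi> T"
    using has_real_derivative_neg_dec_right[OF deriv[of T]] T' b by auto
  define h where "h = min (d / 2) (b - T)"
  have "h > 0" "h < d" "T + h \<le> b" using \<open>d > 0\<close> T' by (auto simp: h_def)
  then have "T + h \<in> S" using d[of h] T' b \<open>\<phi> T = 0\<close> by (auto simp: S_def)
  then show False using T(2) \<open>h > 0\<close> by fastforce
qed

lemma grad_inner: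
  assumes "H differentiable (at z)"
  shows "grad H z \<bullet> w = frechet_derivative H (at z) w"
proof -
  have lin: "linear (frechet_derivative H (at z))"
    using assms by (simp add: frechet_derivative_works has_derivative_linear)
  have "frechet_derivative H (at z) w = frechet_derivative H (at z) (\<Sum>i\<in>UNIV. (w $ i) *\<^sub>R axis i 1)"
    using basis_expansion[of w] by (simp add: scalar_mult_eq_scaleR)
  also have "\<dots> = (\<Sum>i\<in>UNIV. w $ i * frechet_derivative H (at z) (axis i 1))"
    by (simp add: linear_sum[OF lin] linear_scale[OF lin])
  finally show ?thesis by (simp add: grad_def inner_vec_def mult.commute)
qed

text \<open>Supplies the point of the manifold at which the rank-one condition is applied, with the
  sign of the gradient against \<open>x - y\<close> that \<open>rank_one_measure_zero\<close> asks
  for.\<close>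

lemma segment_upward_crossing:
  fixes H :: "real^'n \<Rightarrow> real"
  assumes diff: "\<And>s. s \<in> {0..1} \<Longrightarrow> H differentiable (at (y + s *\<^sub>R (x - y)))"
    and "H y \<le> 0" "H x \<ge> 0"
  shows "\<exists>s\<in>{0..1}. H (y + s *\<^sub>R (x - y)) = 0 \<and> grad H (y + s *\<^sub>R (x - y)) \<bullet> (x - y) \<ge> 0"
proof (rule upward_crossing_exists)
  fix s :: real assume s: "s \<in> {0..1}"
  let ?z = "y + s *\<^sub>R (x - y)"
  have "(H has_derivative frechet_derivative H (at ?z)) (at ?z)"
    using diff[OF s] by (simp add: frechet_derivative_works)
  moreover have "((\<lambda>s. y + s *\<^sub>R (x - y)) has_derivative (\<lambda>s. s *\<^sub>R (x - y))) (at s within {0..1})"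
    by (auto intro!: derivative_eq_intros)
  ultimately have "((\<lambda>s. H (y + s *\<^sub>R (x - y))) has_derivative
      (\<lambda>t. frechet_derivative H (at ?z) (t *\<^sub>R (x - y)))) (at s within {0..1})"
    by (rule has_derivative_compose[rotated])
  then show "((\<lambda>s. H (y + s *\<^sub>R (x - y))) has_real_derivative
      grad H ?z \<bullet> (x - y)) (at s within {0..1})"
    unfolding grad_inner[OF diff[OF s], symmetric]
    by (simp add: has_field_derivative_def mult_commute_abs)
qed (use assms in auto)

section \<open>Filippov values of the bimodal field\<close>

text \<open>A closed neighbourhood of a compact convex set is closed and convex, so it contains the
  closed convex hull of all values near \<open>x\<close>; shrinking the neighbourhoods leaves
  \<open>S\<close>. The null set \<open>{}\<close> is the member of the intersection that is
  inspected.\<close>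

lemma filippov_map_subset:
  assumes "compact S" "convex S"
    and near: "\<And>e. e > 0 \<Longrightarrow> \<exists>d>0. \<forall>q\<in>ball x d \<inter> D. \<exists>s\<in>S. dist (f q) s \<le> e"
  shows "filippov_map D f x \<subseteq> S"
proof
  fix v assume v: "v \<in> filippov_map D f x"
  have "\<exists>s\<in>S. dist s v < e" if "e > 0" for e
  proof -
    obtain d where d: "d > 0" "\<forall>q\<in>ball x d \<inter> D. \<exists>s\<in>S. dist (f q) s \<le> e / 2"
      using near[of "e / 2"] \<open>e > 0\<close> by auto
    \<comment> \<open>The closed neighbourhood of \<open>S\<close> of radius \<open>e / 2\<close>,
      written as a Minkowski sum so that convexity and closedness are inherited from the
      summands.\<close>
    define T where "T = (\<Union>a\<in>S. \<Union>b\<in>cball 0 (e / 2). {a + b})"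
    have "f ` (ball x d \<inter> D) \<subseteq> T"
    proof (rule image_subsetI)
      fix q assume "q \<in> ball x d \<inter> D"
      then obtain s where s: "s \<in> S" "dist (f q) s \<le> e / 2" using d(2) by blast
      then have "f q - s \<in> cball 0 (e / 2)" by (simp add: dist_norm norm_minus_commute)
      moreover have "f q = s + (f q - s)" by simp
      ultimately show "f q \<in> T" unfolding T_def using s(1) by blast
    qed
    moreover have "convex T"
      unfolding T_def using \<open>convex S\<close> by (intro convex_sums) auto
    moreover have "closed T"
      using compact_closed_sums[OF \<open>compact S\<close> closed_cball[of 0 "e / 2"]]
      by (simp add: T_def UNION_singleton_eq_range Setcompr_eq_image)
    ultimately have "closure (convex hull (f ` (ball x d \<inter> D))) \<subseteq> T"
      by (simp add: hull_minimal closure_minimal)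
    moreover have "v \<in> closure (convex hull (f ` (ball x d \<inter> D - {})))"
      using v \<open>d > 0\<close> unfolding filippov_map_def by blast
    ultimately have "v \<in> T" by auto
    then obtain s b where "s \<in> S" "norm b \<le> e / 2" "v = s + b" unfolding T_def by auto
    then show ?thesis using \<open>e > 0\<close> by (intro bexI[of _ s]) (auto simp: dist_norm)
  qed
  then have "v \<in> closure S" by (simp add: closure_approachable)
  then show "v \<in> S" using \<open>compact S\<close> by (simp add: compact_imp_closed)
qed

text \<open>The admissible weights of \<open>fp\<close> in a Filippov velocity: determined off the
  manifold, free in the unit interval on it.\<close>

definition filippov_weight :: "('a \<Rightarrow> real) \<Rightarrow> 'a \<Rightarrow> real \<Rightarrow> bool" where
  "filippov_weight H x l \<longleftrightarrow> 0 \<le> l \<and> l \<le> 1 \<and> (H x > 0 \<longrightarrow> l = 1) \<and> (H x < 0 \<longrightarrow> l = 0)"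

text \<open>Off the manifold \<open>H\<close> keeps its sign near \<open>x\<close>, so only one of
  the two fields contributes. On it, every nearby value is close to one of the endpoints of the
  segment from \<open>fm x\<close> to \<open>fp x\<close>.\<close>

lemma bimodal_map_weight:
  fixes fp fm :: "'a::euclidean_space \<Rightarrow> 'a"
  assumes "open U" "x \<in> U" and H: "continuous_on U H"
    and fp: "continuous_on U fp" and fm: "continuous_on U fm"
    and v: "v \<in> bimodal_map U H fp fm x"
  shows "\<exists>l. filippov_weight H x l \<and> v = l *\<^sub>R fp x + (1 - l) *\<^sub>R fm x"
proof -
  let ?D = "S_plus U H \<union> S_minus U H"
  let ?f = "\<lambda>x. if x \<in> S_plus U H then fp x else fm x"
  have tend: "(H \<longlongrightarrow> H x) (nhds x)" "(fp \<longlongrightarrow> fp x) (nhds x)" "(fm \<longlongrightarrow> fm x) (nhds x)"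
    using assms by (auto simp: continuous_on_eq_continuous_at isCont_def tendsto_nhds_iff)
  have close: "eventually (\<lambda>q. dist (fp q) (fp x) < e \<and> dist (fm q) (fm x) < e) (nhds x)"
    if "e > 0" for e
    using tend(2,3) that by (auto simp: tendsto_iff intro: eventually_conj)
  consider "H x > 0" | "H x < 0" | "H x = 0" by linarith
  then show ?thesis
  proof cases
    case 1
    have "filippov_map ?D ?f x \<subseteq> {fp x}"
    proof (rule filippov_map_subset)
      fix e :: real assume "e > 0"
      have "eventually (\<lambda>q. q \<in> ball x 1 \<inter> ?D \<longrightarrow> dist (?f q) (fp x) \<le> e) (nhds x)"
        using close[OF \<open>e > 0\<close>] order_tendstoD(1)[OF tend(1) 1]
        by eventually_elim (auto simp: S_plus_def S_minus_def)
      then obtain d where "d > 0" "\<And>q. dist q x < d \<Longrightarrow> q \<in> ball x 1 \<inter> ?D \<longrightarrow> dist (?f q) (fp x) \<le> e"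
        unfolding eventually_nhds_metric by blast
      then show "\<exists>d>0. \<forall>q\<in>ball x d \<inter> ?D. \<exists>s\<in>{fp x}. dist (?f q) s \<le> e"
        by (intro exI[of _ "min d 1"]) (auto simp: dist_commute)
    qed auto
    then have "v = fp x" using v by (auto simp: bimodal_map_def)
    then show ?thesis using 1 by (intro exI[of _ 1]) (auto simp: filippov_weight_def)
  next
    case 2
    have "filippov_map ?D ?f x \<subseteq> {fm x}"
    proof (rule filippov_map_subset)
      fix e :: real assume "e > 0"
      have "eventually (\<lambda>q. q \<in> ball x 1 \<inter> ?D \<longrightarrow> dist (?f q) (fm x) \<le> e) (nhds x)"
        using close[OF \<open>e > 0\<close>] order_tendstoD(2)[OF tend(1) 2]
        by eventually_elim (auto simp: S_plus_def S_minus_def)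
      then obtain d where "d > 0" "\<And>q. dist q x < d \<Longrightarrow> q \<in> ball x 1 \<inter> ?D \<longrightarrow> dist (?f q) (fm x) \<le> e"
        unfolding eventually_nhds_metric by blast
      then show "\<exists>d>0. \<forall>q\<in>ball x d \<inter> ?D. \<exists>s\<in>{fm x}. dist (?f q) s \<le> e"
        by (intro exI[of _ "min d 1"]) (auto simp: dist_commute)
    qed auto
    then have "v = fm x" using v by (auto simp: bimodal_map_def)
    then show ?thesis using 2 by (intro exI[of _ 0]) (auto simp: filippov_weight_def)
  next
    case 3
    have "filippov_map ?D ?f x \<subseteq> closed_segment (fm x) (fp x)"
    proof (rule filippov_map_subset)
      fix e :: real assume "e > 0"
      obtain d where "d > 0" and d: "\<And>q. dist q x < d \<Longrightarrow> dist (fp q) (fp x) < e \<and> dist (fm q) (fm x) < e"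
        using close[OF \<open>e > 0\<close>] unfolding eventually_nhds_metric by blast
      have "\<exists>s\<in>closed_segment (fm x) (fp x). dist (?f q) s \<le> e" if "q \<in> ball x d" for q
      proof -
        have "fp x \<in> closed_segment (fm x) (fp x)" "fm x \<in> closed_segment (fm x) (fp x)" by auto
        moreover have "dist (fp q) (fp x) \<le> e" "dist (fm q) (fm x) \<le> e"
          using that d[of q] by (auto simp: dist_commute)
        ultimately show ?thesis by (cases "q \<in> S_plus U H") auto
      qed
      then show "\<exists>d>0. \<forall>q\<in>ball x d \<inter> ?D. \<exists>s\<in>closed_segment (fm x) (fp x). dist (?f q) s \<le> e"
        using \<open>d > 0\<close> by blast
    qed auto
    then obtain l where "0 \<le> l" "l \<le> 1" "v = (1 - l) *\<^sub>R fm x + l *\<^sub>R fp x"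
      using v unfolding bimodal_map_def closed_segment_def by blast
    then show ?thesis using 3 by (intro exI[of _ l]) (auto simp: filippov_weight_def)
  qed
qed

text \<open>Each such point is assigned a rational in the gap to its right. If two points
  \<open>s < t\<close> shared a rational, then \<open>t\<close> would lie in the gap of
  \<open>s\<close>.\<close>

lemma countable_right_isolated:
  fixes A :: "real set"
  shows "countable {t \<in> A. \<exists>d>0. {t<..<t + d} \<inter> A = {}}" (is "countable ?I")
proof -
  have "\<exists>q. q \<in> \<rat> \<and> t < q \<and> {t<..<q} \<inter> A = {}" if "t \<in> ?I" for t
  proof -
    obtain d where d: "d > 0" "{t<..<t + d} \<inter> A = {}" using \<open>t \<in> ?I\<close> by auto
    obtain q where q: "q \<in> \<rat>" "t < q" "q < t + d" using Rats_dense_in_real[of t "t + d"] d(1) by auto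
    have "{t<..<q} \<subseteq> {t<..<t + d}" using q by auto
    then show ?thesis using d(2) q by blast
  qed
  note ex = this
  define q where "q t = (SOME q. q \<in> \<rat> \<and> t < q \<and> {t<..<q} \<inter> A = {})" for t
  have q: "q t \<in> \<rat> \<and> t < q t \<and> {t<..<q t} \<inter> A = {}" if "t \<in> ?I" for t
    unfolding q_def by (rule someI_ex[OF ex[OF that]])
  have "inj_on q ?I"
  proof (rule linorder_inj_onI)
    fix s t assume st: "s < t" "s \<in> ?I" "t \<in> ?I"
    show "q s \<noteq> q t"
    proof
      assume "q s = q t"
      then have "t \<in> {s<..<q s} \<inter> A" using q[OF st(3)] st by auto
      then show False using q[OF st(2)] by blast
    qed
  qed auto
  moreover have "countable (q ` ?I)" using q by (intro countable_subset[OF _ countable_rat]) auto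
  ultimately show ?thesis by (rule countable_image_inj_on[rotated])
qed

text \<open>Moving from \<open>p\<close> along the gradient and against it reaches both sides. Hence
  both measure bounds are available at every point of the manifold.\<close>

lemma regular_point_in_closures:
  fixes H :: "real^'n \<Rightarrow> real"
  assumes "open U" "p \<in> U" "H differentiable (at p)" "H p = 0" "grad H p \<noteq> 0"
  shows "p \<in> closure (S_plus U H)" "p \<in> closure (S_minus U H)"
proof -
  define g where "g = grad H p"
  have gg: "g \<bullet> g > 0" using assms by (simp add: g_def)
  define \<phi> where "\<phi> t = H (p + t *\<^sub>R g)" for t
  have "(H has_derivative frechet_derivative H (at p)) (at (p + 0 *\<^sub>R g))"
    using assms by (simp flip: frechet_derivative_works)
  moreover have "((\<lambda>t. p + t *\<^sub>R g) has_derivative (\<lambda>t. t *\<^sub>R g)) (at 0)"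
    by (auto intro!: derivative_eq_intros)
  ultimately have "(\<phi> has_derivative (\<lambda>t. frechet_derivative H (at p) (t *\<^sub>R g))) (at 0)"
    unfolding \<phi>_def by (rule has_derivative_compose[rotated])
  then have "(\<phi> has_real_derivative g \<bullet> g) (at 0)"
    unfolding grad_inner[OF assms(3), symmetric]
    by (simp add: has_field_derivative_def mult_commute_abs flip: g_def)
  note \<phi>' = this
  obtain d1 where d1: "d1 > 0" "\<And>t. 0 < t \<Longrightarrow> t < d1 \<Longrightarrow> \<phi> t > \<phi> 0"
    using DERIV_pos_inc_right[OF \<phi>' gg] by auto
  obtain d2 where d2: "d2 > 0" "\<And>t. 0 < t \<Longrightarrow> t < d2 \<Longrightarrow> \<phi> (- t) < \<phi> 0"
    using DERIV_pos_inc_left[OF \<phi>' gg] by auto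
  obtain r where r: "r > 0" "ball p r \<subseteq> U" using assms openE by blast
  have \<phi>0: "\<phi> 0 = 0" by (simp add: \<phi>_def assms)
  have small: "\<exists>t>0. t < d \<and> norm (t *\<^sub>R g) < e" if "d > 0" "e > 0" for d e
  proof -
    have "norm g > 0" using gg by auto
    then show ?thesis using that
      by (intro exI[of _ "min (d / 2) (e / (2 * norm g))"]) (auto simp: min_def field_simps)
  qed
  show "p \<in> closure (S_plus U H)"
    unfolding closure_approachable
  proof (intro allI impI)
    fix e :: real assume "e > 0"
    then obtain t where t: "0 < t" "t < d1" "norm (t *\<^sub>R g) < min r e" using small[of d1 "min r e"] d1 r by auto
    then have "p + t *\<^sub>R g \<in> ball p r" "H (p + t *\<^sub>R g) > 0"
      using d1(2)[of t] by (auto simp: \<phi>0 dist_norm \<phi>_def[symmetric])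
    then have "p + t *\<^sub>R g \<in> S_plus U H" using r by (auto simp: S_plus_def)
    then show "\<exists>y\<in>S_plus U H. dist y p < e"
      using t by (intro bexI[of _ "p + t *\<^sub>R g"]) (auto simp: dist_norm)
  qed
  show "p \<in> closure (S_minus U H)"
    unfolding closure_approachable
  proof (intro allI impI)
    fix e :: real assume "e > 0"
    then obtain t where t: "0 < t" "t < d2" "norm (t *\<^sub>R g) < min r e" using small[of d2 "min r e"] d2 r by auto
    then have "p + (- t) *\<^sub>R g \<in> ball p r" "H (p + (- t) *\<^sub>R g) < 0"
      using d2(2)[of t] by (auto simp: \<phi>0 dist_norm \<phi>_def[symmetric] simp del: scaleR_minus_left)
    then have "p + (- t) *\<^sub>R g \<in> S_minus U H" using r by (auto simp: S_minus_def)
    then show "\<exists>y\<in>S_minus U H. dist y p < e"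
      using t by (intro bexI[of _ "p + (- t) *\<^sub>R g"]) (auto simp: dist_norm)
  qed
qed

subsection \<open>Contraction of nearby solutions\<close>

text \<open>Both fields share one rate \<open>c\<close>, and the rank-one condition enters only
  through its consequence \<open>jump\<close>.\<close>

locale bimodal_contraction =
  fixes U :: "(real^'n) set" and H N :: "real^'n \<Rightarrow> real" and fp fm :: "real^'n \<Rightarrow> real^'n"
    and c :: real
  assumes open_U: "open U"
    and fp: "Ck_on 1 fp U" and fm: "Ck_on 1 fm U"
    and H_diff: "\<And>x. x \<in> U \<Longrightarrow> H differentiable (at x)"
    and regular: "\<And>x. x \<in> U \<Longrightarrow> H x = 0 \<Longrightarrow> grad H x \<noteq> 0"
    and N: "is_norm N"
    and measure_fp: "\<And>x. x \<in> closure (S_plus U H) \<Longrightarrow> x \<in> U \<Longrightarrow>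
      matrix_measure N (jacobian fp (at x)) \<le> - c"
    and measure_fm: "\<And>x. x \<in> closure (S_minus U H) \<Longrightarrow> x \<in> U \<Longrightarrow>
      matrix_measure N (jacobian fm (at x)) \<le> - c"
    and jump: "\<And>x W a. x \<in> U \<Longrightarrow> H x = 0 \<Longrightarrow> grad H x \<bullet> W \<ge> 0 \<Longrightarrow> a \<ge> 0 \<Longrightarrow>
      N W \<le> N (W - a *\<^sub>R (fp x - fm x))"
begin

lemma cont_H: "continuous_on U H"
  by (meson H_diff continuous_at_imp_continuous_on differentiable_imp_continuous_within)

lemma cont_fp: "continuous_on U fp" and cont_fm: "continuous_on U fm"
  using fp fm by (auto intro!: continuous_at_imp_continuous_on differentiable_imp_continuous_within)

definition velocity :: "real \<Rightarrow> real^'n \<Rightarrow> real^'n" where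
  "velocity l x = l *\<^sub>R fp x + (1 - l) *\<^sub>R fm x"

definition contracting_ball :: "real \<Rightarrow> real^'n \<Rightarrow> real \<Rightarrow> bool" where
  "contracting_ball k p r \<longleftrightarrow> r > 0 \<and> cball p r \<subseteq> U \<and>
    (\<exists>d>0. \<forall>x\<in>ball p r. \<forall>y\<in>ball p r. \<forall>l m s h.
      filippov_weight H x l \<longrightarrow> filippov_weight H y m \<longrightarrow> m \<le> l \<longrightarrow> 0 \<le> s \<longrightarrow> s \<le> 1 \<longrightarrow>
      0 < h \<longrightarrow> h < d \<longrightarrow>
      N ((x - y) + h *\<^sub>R (velocity l x - velocity m y
          - (l - m) *\<^sub>R (fp (y + s *\<^sub>R (x - y)) - fm (y + s *\<^sub>R (x - y)))))
        \<le> (1 - h * k) * N (x - y))"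

text \<open>Off the manifold a small ball lies on one side, so \<open>l = m\<close> and the
  contraction of a single field suffices. At a point of the manifold both fields contract nearby,
  and the corrected difference is a convex combination of Euler steps.\<close>

lemma contracting_ball_exists:
  assumes p: "p \<in> U" and "k < c"
  shows "\<exists>r. contracting_ball k p r"
proof -
  have fp_ball: "\<exists>r>0. \<exists>d>0. ball p r \<subseteq> U \<and> (\<forall>x\<in>ball p r. \<forall>y\<in>ball p r. \<forall>h. 0 < h \<longrightarrow> h < d \<longrightarrow>
      N ((x - y) + h *\<^sub>R (fp x - fp y)) \<le> (1 - h * k) * N (x - y))"
    if "p \<in> closure (S_plus U H)"
    by (rule measure_contraction[OF open_U fp p N measure_fp[OF that p] \<open>k < c\<close>])
  have fm_ball: "\<exists>r>0. \<exists>d>0. ball p r \<subseteq> U \<and> (\<forall>x\<in>ball p r. \<forall>y\<in>ball p r. \<forall>h. 0 < h \<longrightarrow> h < d \<longrightarrow>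
      N ((x - y) + h *\<^sub>R (fm x - fm y)) \<le> (1 - h * k) * N (x - y))"
    if "p \<in> closure (S_minus U H)"
    by (rule measure_contraction[OF open_U fm p N measure_fm[OF that p] \<open>k < c\<close>])
  have H_at: "(H \<longlongrightarrow> H p) (nhds p)"
    using cont_H open_U p
    by (simp add: continuous_on_eq_continuous_at isCont_def tendsto_nhds_iff)
  consider "H p > 0" | "H p < 0" | "H p = 0" by linarith
  then show ?thesis
  proof cases
    case 1
    have "p \<in> closure (S_plus U H)" using 1 p closure_subset by (force simp: S_plus_def)
    from fp_ball[OF this] obtain r1 d where r1: "r1 > 0" "d > 0" "ball p r1 \<subseteq> U"
      and le: "\<And>x y h. x \<in> ball p r1 \<Longrightarrow> y \<in> ball p r1 \<Longrightarrow> 0 < h \<Longrightarrow> h < d \<Longrightarrow>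
        N ((x - y) + h *\<^sub>R (fp x - fp y)) \<le> (1 - h * k) * N (x - y)" by blast
    obtain r2 where r2: "r2 > 0" "\<And>q. dist q p < r2 \<Longrightarrow> H q > 0"
      using order_tendstoD(1)[OF H_at 1] unfolding eventually_nhds_metric by blast
    \<comment> \<open>Halving the radius puts the closed ball inside the open ball that lies in
      \<open>U\<close>.\<close>
    have "contracting_ball k p (min r1 r2 / 2)"
      unfolding contracting_ball_def
    proof (intro conjI exI[of _ d] ballI allI impI)
      show "cball p (min r1 r2 / 2) \<subseteq> U" using r1 r2(1) by (force simp: subset_iff)
      fix x y :: "real^'n" and l m s h :: real
      assume "x \<in> ball p (min r1 r2 / 2)" "y \<in> ball p (min r1 r2 / 2)"
      then have x: "x \<in> ball p r1" "dist x p < r2" and y: "y \<in> ball p r1" "dist y p < r2"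
        using r1(1) r2(1) by (auto simp: dist_commute)
      assume "filippov_weight H x l" "filippov_weight H y m" and h: "0 < h" "h < d"
      then have "l = 1" "m = 1" using r2(2)[OF x(2)] r2(2)[OF y(2)] by (auto simp: filippov_weight_def)
      then show "N ((x - y) + h *\<^sub>R (velocity l x - velocity m y
          - (l - m) *\<^sub>R (fp (y + s *\<^sub>R (x - y)) - fm (y + s *\<^sub>R (x - y)))))
        \<le> (1 - h * k) * N (x - y)"
        using le[OF x(1) y(1) h] by (simp add: velocity_def)
    qed (use r1 r2 in auto)
    then show ?thesis by blast
  next
    case 2
    have "p \<in> closure (S_minus U H)" using 2 p closure_subset by (force simp: S_minus_def)
    from fm_ball[OF this] obtain r1 d where r1: "r1 > 0" "d > 0" "ball p r1 \<subseteq> U"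
      and le: "\<And>x y h. x \<in> ball p r1 \<Longrightarrow> y \<in> ball p r1 \<Longrightarrow> 0 < h \<Longrightarrow> h < d \<Longrightarrow>
        N ((x - y) + h *\<^sub>R (fm x - fm y)) \<le> (1 - h * k) * N (x - y)" by blast
    obtain r2 where r2: "r2 > 0" "\<And>q. dist q p < r2 \<Longrightarrow> H q < 0"
      using order_tendstoD(2)[OF H_at 2] unfolding eventually_nhds_metric by blast
    have "contracting_ball k p (min r1 r2 / 2)"
      unfolding contracting_ball_def
    proof (intro conjI exI[of _ d] ballI allI impI)
      show "cball p (min r1 r2 / 2) \<subseteq> U" using r1 r2(1) by (force simp: subset_iff)
      fix x y :: "real^'n" and l m s h :: real
      assume "x \<in> ball p (min r1 r2 / 2)" "y \<in> ball p (min r1 r2 / 2)"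
      then have x: "x \<in> ball p r1" "dist x p < r2" and y: "y \<in> ball p r1" "dist y p < r2"
        using r1(1) r2(1) by (auto simp: dist_commute)
      assume "filippov_weight H x l" "filippov_weight H y m" and h: "0 < h" "h < d"
      then have "l = 0" "m = 0" using r2(2)[OF x(2)] r2(2)[OF y(2)] by (auto simp: filippov_weight_def)
      then show "N ((x - y) + h *\<^sub>R (velocity l x - velocity m y
          - (l - m) *\<^sub>R (fp (y + s *\<^sub>R (x - y)) - fm (y + s *\<^sub>R (x - y)))))
        \<le> (1 - h * k) * N (x - y)"
        using le[OF x(1) y(1) h] by (simp add: velocity_def)
    qed (use r1 r2 in auto)
    then show ?thesis by blast
  next
    case 3
    note cl = regular_point_in_closures[OF open_U p H_diff[OF p] 3 regular[OF p 3]]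
    obtain r1 d1 where r1: "r1 > 0" "d1 > 0" "ball p r1 \<subseteq> U"
      and le_p: "\<And>x y h. x \<in> ball p r1 \<Longrightarrow> y \<in> ball p r1 \<Longrightarrow> 0 < h \<Longrightarrow> h < d1 \<Longrightarrow>
        N ((x - y) + h *\<^sub>R (fp x - fp y)) \<le> (1 - h * k) * N (x - y)" using fp_ball[OF cl(1)] by blast
    obtain r2 d2 where r2: "r2 > 0" "d2 > 0" "ball p r2 \<subseteq> U"
      and le_m: "\<And>x y h. x \<in> ball p r2 \<Longrightarrow> y \<in> ball p r2 \<Longrightarrow> 0 < h \<Longrightarrow> h < d2 \<Longrightarrow>
        N ((x - y) + h *\<^sub>R (fm x - fm y)) \<le> (1 - h * k) * N (x - y)" using fm_ball[OF cl(2)] by blast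
    define r where "r = min r1 r2 / 2"
    have "contracting_ball k p r"
      unfolding contracting_ball_def
    proof (intro conjI exI[of _ "min d1 d2"] ballI allI impI)
      show "cball p r \<subseteq> U" using r1 r2(1) by (force simp: subset_iff r_def)
      have sub: "ball p r \<subseteq> ball p r1" "ball p r \<subseteq> ball p r2"
        using r1(1) r2(1) by (auto simp: r_def)
      fix x y :: "real^'n" and l m s h :: real
      assume x: "x \<in> ball p r" and y: "y \<in> ball p r"
        and l: "filippov_weight H x l" and m: "filippov_weight H y m" and "m \<le> l"
        and s: "0 \<le> s" "s \<le> 1" and h: "0 < h" "h < min d1 d2"
      define z where "z = y + s *\<^sub>R (x - y)"
      have "z = (1 - s) *\<^sub>R y + s *\<^sub>R x" by (simp add: z_def algebra_simps)
      then have z: "z \<in> ball p r" using x y s convex_ball[of p r] unfolding convex_alt by auto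
      define P where "P a b = (a - b) + h *\<^sub>R (fp a - fp b)" for a b
      define Q where "Q a b = (a - b) + h *\<^sub>R (fm a - fm b)" for a b
      have P: "N (P a b) \<le> (1 - h * k) * N (a - b)" if "a \<in> ball p r" "b \<in> ball p r" for a b
        unfolding P_def by (rule le_p) (use that subsetD[OF sub(1)] h in simp_all)
      have Q: "N (Q a b) \<le> (1 - h * k) * N (a - b)" if "a \<in> ball p r" "b \<in> ball p r" for a b
        unfolding Q_def by (rule le_m) (use that subsetD[OF sub(2)] h in simp_all)
      have xz: "x - z = (1 - s) *\<^sub>R (x - y)" and zy: "z - y = s *\<^sub>R (x - y)"
        by (simp_all add: z_def algebra_simps)
      \<comment> \<open>Since \<open>z\<close> lies on the segment, the triangle inequality is an
        equality here, so following \<open>fm\<close> from \<open>y\<close> to \<open>z\<close> and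
        \<open>fp\<close> from \<open>z\<close> to \<open>x\<close> costs no constant.\<close>
      have split: "N (x - z) + N (z - y) = N (x - y)"
        unfolding xz zy is_norm_scaleR[OF N] using s by (simp add: left_diff_distrib)
      have PQ: "N (P x z + Q z y) \<le> (1 - h * k) * N (x - y)"
        using is_norm_triangle[OF N, of "P x z" "Q z y"] P[OF x z] Q[OF z y]
        unfolding split[symmetric] distrib_left by linarith
      have lm: "0 \<le> m" "0 \<le> 1 - l" "0 \<le> l - m"
        using l m \<open>m \<le> l\<close> by (auto simp: filippov_weight_def)
      \<comment> \<open>The weights \<open>m\<close>, \<open>1 - l\<close> and \<open>l - m\<close>
        are nonnegative because \<open>m \<le> l\<close>, and they add up to 1.\<close>
      have "(x - y) + h *\<^sub>R (velocity l x - velocity m y - (l - m) *\<^sub>R (fp z - fm z))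
          = m *\<^sub>R P x y + (1 - l) *\<^sub>R Q x y + (l - m) *\<^sub>R (P x z + Q z y)"
        by (simp add: velocity_def P_def Q_def algebra_simps)
      also have "N \<dots> \<le> N (m *\<^sub>R P x y) + N ((1 - l) *\<^sub>R Q x y) + N ((l - m) *\<^sub>R (P x z + Q z y))"
        by (meson N add_right_mono is_norm_triangle order_trans)
      also have "\<dots> = m * N (P x y) + (1 - l) * N (Q x y) + (l - m) * N (P x z + Q z y)"
        using lm by (simp add: is_norm_scaleR[OF N])
      also have "\<dots> \<le> m * ((1 - h * k) * N (x - y)) + (1 - l) * ((1 - h * k) * N (x - y))
          + (l - m) * ((1 - h * k) * N (x - y))"
        using P[OF x y] Q[OF x y] PQ lm by (intro add_mono mult_left_mono)
      also have "\<dots> = (1 - h * k) * N (x - y)" by (simp add: algebra_simps)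
      finally show "N ((x - y) + h *\<^sub>R (velocity l x - velocity m y
          - (l - m) *\<^sub>R (fp (y + s *\<^sub>R (x - y)) - fm (y + s *\<^sub>R (x - y)))))
        \<le> (1 - h * k) * N (x - y)" unfolding z_def .
    qed (use r1 r2 in \<open>auto simp: r_def\<close>)
    then show ?thesis by blast
  qed
qed

section \<open>One step of the distance between two solutions\<close>

text \<open>The distance to be bounded is the one at time \<open>t + h\<close>, so the jump is
  subtracted there, at a crossing point between the later positions. First-order expansion then
  leads back to the positions at time \<open>t\<close>, where the contracting ball applies with the
  same segment parameter \<open>s\<close>. The crossing is asked for only if
  \<open>m < l\<close>.\<close>

lemma distance_step_ordered:
  assumes ball: "contracting_ball k p r" and xt: "x t \<in> ball p r" and yt: "y t \<in> ball p r"
    and dx: "(x has_vector_derivative velocity l (x t)) (at t within {t0..})"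
    and dy: "(y has_vector_derivative velocity m (y t)) (at t within {t0..})"
    and t: "t0 \<le> t"
    and l: "filippov_weight H (x t) l" and m: "filippov_weight H (y t) m" and "m \<le> l"
    and freq: "\<And>d. d > 0 \<Longrightarrow> m < l \<Longrightarrow> \<exists>h>0. h < d \<and> 0 \<le> H (x (t + h)) \<and> H (y (t + h)) \<le> 0"
    and "e > 0" "d > 0"
  shows "\<exists>h>0. h < d \<and> N (x (t + h) - y (t + h)) \<le> (1 - h * k) * N (x t - y t) + e * h"
proof -
  define u where "u z = fp z - fm z" for z
  obtain d0 where r: "r > 0" "cball p r \<subseteq> U" and "d0 > 0"
    and contr: "\<And>s h. 0 \<le> s \<Longrightarrow> s \<le> 1 \<Longrightarrow> 0 < h \<Longrightarrow> h < d0 \<Longrightarrow>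
      N ((x t - y t) + h *\<^sub>R (velocity l (x t) - velocity m (y t)
          - (l - m) *\<^sub>R u (y t + s *\<^sub>R (x t - y t)))) \<le> (1 - h * k) * N (x t - y t)"
    using ball xt yt l m \<open>m \<le> l\<close> unfolding contracting_ball_def u_def by blast
  have lm: "0 \<le> l - m" "l - m \<le> 1" using l m \<open>m \<le> l\<close> by (auto simp: filippov_weight_def)
  \<comment> \<open>Three errors occur: the remainders of \<open>x\<close> and of \<open>y\<close>,
    and the change of \<open>u\<close> between the crossing point and its counterpart at time
    \<open>t\<close>.\<close>
  define e1 where "e1 = e / 3"
  have "e1 > 0" using \<open>e > 0\<close> by (simp add: e1_def)
  obtain d1 where "d1 > 0" and d1: "\<And>h. 0 < h \<Longrightarrow> h < d1 \<Longrightarrow>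
      N (x (t + h) - x t - h *\<^sub>R velocity l (x t)) \<le> e1 * h"
    using has_vector_derivative_is_norm_le[OF N dx \<open>e1 > 0\<close>] t
    by (metis (no_types, lifting) abs_of_pos add_diff_cancel_left' add_increasing2 atLeast_iff less_imp_le)
  obtain d2 where "d2 > 0" and d2: "\<And>h. 0 < h \<Longrightarrow> h < d2 \<Longrightarrow>
      N (y (t + h) - y t - h *\<^sub>R velocity m (y t)) \<le> e1 * h"
    using has_vector_derivative_is_norm_le[OF N dy \<open>e1 > 0\<close>] t
    by (metis (no_types, lifting) abs_of_pos add_diff_cancel_left' add_increasing2 atLeast_iff less_imp_le)
  obtain M where M: "M > 0" "\<And>v. N v \<le> M * norm v" using is_norm_le_norm[OF N] by blast
  \<comment> \<open>The segment parameter depends on \<open>h\<close>, so the modulus of continuity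
    of \<open>u\<close> must hold uniformly over the ball.\<close>
  have "continuous_on (cball p r) u"
    unfolding u_def using continuous_on_subset[OF cont_fp r(2)] continuous_on_subset[OF cont_fm r(2)]
    by (intro continuous_on_diff)
  then have "uniformly_continuous_on (cball p r) u" by (rule compact_uniformly_continuous) simp
  moreover have "e1 / M > 0" using \<open>e1 > 0\<close> M by simp
  ultimately obtain d3 where "d3 > 0" and d3: "\<And>a b. a \<in> cball p r \<Longrightarrow> b \<in> cball p r \<Longrightarrow>
      dist a b < d3 \<Longrightarrow> dist (u a) (u b) < e1 / M"
    unfolding uniformly_continuous_on_def by metis
  have near: "\<exists>d'>0. \<forall>h. 0 < h \<longrightarrow> h < d' \<longrightarrow> f (t + h) \<in> ball p r \<and> dist (f (t + h)) (f t) < d3 / 2"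
    if f: "(f has_vector_derivative v) (at t within {t0..})" and ft: "f t \<in> ball p r"
    for f v
  proof -
    have f_tend: "(f \<longlongrightarrow> f t) (at t within {t0..})"
      using has_vector_derivative_continuous[OF f] by (simp add: continuous_within)
    have "eventually (\<lambda>s. f s \<in> ball p r \<and> dist (f s) (f t) < d3 / 2) (at t within {t0..})"
      using topological_tendstoD[OF f_tend open_ball ft] tendstoD[OF f_tend, of "d3 / 2"] \<open>d3 > 0\<close>
      by (auto intro: eventually_conj)
    then obtain d' where "d' > 0" and d': "\<And>s. s \<in> {t0..} \<Longrightarrow> s \<noteq> t \<Longrightarrow> dist s t < d' \<Longrightarrow>
        f s \<in> ball p r \<and> dist (f s) (f t) < d3 / 2"
      unfolding eventually_at by blast
    have "f (t + h) \<in> ball p r \<and> dist (f (t + h)) (f t) < d3 / 2" if "0 < h" "h < d'" for h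
      by (rule d') (use that t in \<open>auto simp: dist_real_def\<close>)
    then show ?thesis using \<open>d' > 0\<close> by blast
  qed
  obtain d4 where "d4 > 0" and d4: "\<And>h. 0 < h \<Longrightarrow> h < d4 \<Longrightarrow>
      x (t + h) \<in> ball p r \<and> dist (x (t + h)) (x t) < d3 / 2" using near[OF dx xt] by blast
  obtain d5 where "d5 > 0" and d5: "\<And>h. 0 < h \<Longrightarrow> h < d5 \<Longrightarrow>
      y (t + h) \<in> ball p r \<and> dist (y (t + h)) (y t) < d3 / 2" using near[OF dy yt] by blast
  define \<delta> where "\<delta> = Min {d, d0, d1, d2, d4, d5}"
  have "\<delta> > 0" using \<open>d > 0\<close> \<open>d0 > 0\<close> \<open>d1 > 0\<close> \<open>d2 > 0\<close> \<open>d4 > 0\<close> \<open>d5 > 0\<close> by (simp add: \<delta>_def)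
  have "\<exists>h>0. h < \<delta> \<and> (m < l \<longrightarrow> 0 \<le> H (x (t + h)) \<and> H (y (t + h)) \<le> 0)"
  proof (cases "m < l")
    case True
    then show ?thesis using freq[OF \<open>\<delta> > 0\<close>] by blast
  next
    case False
    then show ?thesis using \<open>\<delta> > 0\<close> by (intro exI[of _ "\<delta> / 2"]) auto
  qed
  then obtain h where "0 < h" "h < \<delta>" and H: "m < l \<Longrightarrow> 0 \<le> H (x (t + h)) \<and> H (y (t + h)) \<le> 0"
    by blast
  then have h: "h < d" "h < d0" "h < d1" "h < d2" "h < d4" "h < d5" by (simp_all add: \<delta>_def)
  define X where "X = x (t + h)"
  define Y where "Y = y (t + h)"
  have X: "X \<in> ball p r" "dist X (x t) < d3 / 2" and Y: "Y \<in> ball p r" "dist Y (y t) < d3 / 2"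
    using d4[of h] d5[of h] \<open>0 < h\<close> h by (auto simp: X_def Y_def)
  have segment: "b + s *\<^sub>R (a - b) \<in> ball p r"
    if "a \<in> ball p r" "b \<in> ball p r" "0 \<le> s" "s \<le> 1" for a b s
  proof -
    have "b + s *\<^sub>R (a - b) = (1 - s) *\<^sub>R b + s *\<^sub>R a" by (simp add: algebra_simps)
    then show ?thesis using that convex_ball[of p r] unfolding convex_alt by auto
  qed
  \<comment> \<open>For \<open>m < l\<close> this is \<open>jump\<close> with the factor
    \<open>h * (l - m)\<close>; for \<open>l = m\<close> the correction vanishes and any
    \<open>s\<close> serves.\<close>
  have "\<exists>s. 0 \<le> s \<and> s \<le> 1 \<and> N (X - Y) \<le> N (X - Y - (h * (l - m)) *\<^sub>R u (Y + s *\<^sub>R (X - Y)))"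
  proof (cases "m < l")
    case True
    have in_U: "Y + s *\<^sub>R (X - Y) \<in> U" if "0 \<le> s" "s \<le> 1" for s
      using segment[OF X(1) Y(1) that] r(2) by auto
    obtain s where s: "s \<in> {0..1}" "H (Y + s *\<^sub>R (X - Y)) = 0"
        "grad H (Y + s *\<^sub>R (X - Y)) \<bullet> (X - Y) \<ge> 0"
      using segment_upward_crossing[where x = X and y = Y and H = H] H[OF True] in_U H_diff by (auto simp: X_def Y_def)
    have "N (X - Y) \<le> N (X - Y - (h * (l - m)) *\<^sub>R u (Y + s *\<^sub>R (X - Y)))"
      unfolding u_def using s in_U[of s] lm \<open>0 < h\<close> by (intro jump) auto
    then show ?thesis using s by auto
  next
    case False
    then have "l = m" using \<open>m \<le> l\<close> by simp
    then show ?thesis by (intro exI[of _ 0]) simp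
  qed
  then obtain s where s: "0 \<le> s" "s \<le> 1"
    and step: "N (X - Y) \<le> N (X - Y - (h * (l - m)) *\<^sub>R u (Y + s *\<^sub>R (X - Y)))" by blast
  define z where "z = Y + s *\<^sub>R (X - Y)"
  \<comment> \<open>The point with the same parameter on the segment at time \<open>t\<close>; its
    distance to \<open>z\<close> is controlled by the displacements of both solutions.\<close>
  define z' where "z' = y t + s *\<^sub>R (x t - y t)"
  have "z - z' = (1 - s) *\<^sub>R (Y - y t) + s *\<^sub>R (X - x t)" by (simp add: z_def z'_def algebra_simps)
  then have "norm (z - z') \<le> (1 - s) * norm (Y - y t) + s * norm (X - x t)"
    using s by (metis abs_of_nonneg diff_ge_0_iff_ge norm_scaleR norm_triangle_ineq)
  also have "\<dots> \<le> 1 * norm (Y - y t) + 1 * norm (X - x t)"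
    using s by (intro add_mono mult_right_mono) auto
  also have "\<dots> < d3" using X Y by (simp add: dist_norm)
  finally have "dist (u z') (u z) < e1 / M"
    using segment[OF X(1) Y(1) s] segment[OF xt yt s]
    by (intro d3) (auto simp: z_def z'_def dist_norm norm_minus_commute)
  then have "M * norm (u z' - u z) \<le> M * (e1 / M)"
    using M(1) by (intro mult_left_mono) (auto simp: dist_norm)
  then have uz: "N (u z' - u z) \<le> e1" using M by (metis nonzero_mult_div_cancel_left less_irrefl order_trans times_divide_eq_right)
  define A where "A = (x t - y t) + h *\<^sub>R (velocity l (x t) - velocity m (y t) - (l - m) *\<^sub>R u z')"
  define B where "B = X - x t - h *\<^sub>R velocity l (x t)"
  define C where "C = Y - y t - h *\<^sub>R velocity m (y t)"
  \<comment> \<open>\<open>A\<close> is the contracted Euler step at time \<open>t\<close>,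
    \<open>B\<close> and \<open>C\<close> are the remainders of the two solutions, and the last term
    exchanges \<open>u z\<close> for \<open>u z'\<close>.\<close>
  have "X - Y - (h * (l - m)) *\<^sub>R u z = A + (B + (- C + (h * (l - m)) *\<^sub>R (u z' - u z)))"
    by (simp add: A_def B_def C_def algebra_simps)
  then have "N (X - Y) \<le> N (A + (B + (- C + (h * (l - m)) *\<^sub>R (u z' - u z))))"
    using step by (simp add: z_def)
  also have "\<dots> \<le> N A + (N B + (N C + h * (l - m) * N (u z' - u z)))"
    using is_norm_triangle[OF N, of A "B + (- C + (h * (l - m)) *\<^sub>R (u z' - u z))"]
      is_norm_triangle[OF N, of B "- C + (h * (l - m)) *\<^sub>R (u z' - u z)"]
      is_norm_triangle[OF N, of "- C" "(h * (l - m)) *\<^sub>R (u z' - u z)"] lm \<open>0 < h\<close>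
    by (simp add: is_norm_minus[OF N] is_norm_scaleR[OF N])
  also have "\<dots> \<le> (1 - h * k) * N (x t - y t) + (e1 * h + (e1 * h + (h * 1) * e1))"
    using contr[OF s \<open>0 < h\<close> h(2)] d1[OF \<open>0 < h\<close> h(3)] d2[OF \<open>0 < h\<close> h(4)] lm uz \<open>0 < h\<close>
      is_norm_nonneg[OF N]
    by (intro add_mono mult_mono) (auto simp: A_def B_def C_def z'_def X_def Y_def)
  also have "\<dots> = (1 - h * k) * N (x t - y t) + e * h" by (simp add: e1_def)
  finally show ?thesis using \<open>0 < h\<close> h(1) by (auto simp: X_def Y_def)
qed

lemma right_sign_persists:
  fixes f :: "real \<Rightarrow> real^'n"
  assumes f: "continuous (at t within {t0..}) f" and "t0 \<le> t" "f t \<in> U"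
  shows "H (f t) > 0 \<Longrightarrow> \<exists>d>0. \<forall>h. 0 < h \<longrightarrow> h < d \<longrightarrow> H (f (t + h)) > 0"
    and "H (f t) < 0 \<Longrightarrow> \<exists>d>0. \<forall>h. 0 < h \<longrightarrow> h < d \<longrightarrow> H (f (t + h)) < 0"
proof -
  have "isCont H (f t)" using cont_H open_U \<open>f t \<in> U\<close> by (simp add: continuous_on_eq_continuous_at)
  from isCont_tendsto_compose[OF this] have tend: "((\<lambda>s. H (f s)) \<longlongrightarrow> H (f t)) (at t within {t0..})"
    using f unfolding continuous_within by blast
  have ev: "\<exists>d>0. \<forall>h. 0 < h \<longrightarrow> h < d \<longrightarrow> P (t + h)" if P: "eventually P (at t within {t0..})" for P
  proof -
    obtain d where "d > 0" and d: "\<forall>s\<in>{t0..}. s \<noteq> t \<and> dist s t < d \<longrightarrow> P s"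
      using P unfolding eventually_at by blast
    have "P (t + h)" if "0 < h" "h < d" for h
      using d that \<open>t0 \<le> t\<close> by (simp add: dist_real_def)
    then show ?thesis using \<open>d > 0\<close> by blast
  qed
  show "\<exists>d>0. \<forall>h. 0 < h \<longrightarrow> h < d \<longrightarrow> H (f (t + h)) > 0" if "H (f t) > 0"
    by (rule ev[OF order_tendstoD(1)[OF tend that]])
  show "\<exists>d>0. \<forall>h. 0 < h \<longrightarrow> h < d \<longrightarrow> H (f (t + h)) < 0" if "H (f t) < 0"
    by (rule ev[OF order_tendstoD(2)[OF tend that]])
qed

text \<open>A strict sign persists to the right by continuity, whereas a zero value is only known to
  recur at some later times. If both values vanish, the two kinds of recurrence times need not
  coincide, so common zeros must accumulate: hence the separate assumption
  \<open>acc_fg\<close>.\<close>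

lemma opposite_sides_right_frequently:
  fixes f g :: "real \<Rightarrow> real^'n"
  assumes f: "continuous (at t within {t0..}) f" and g: "continuous (at t within {t0..}) g"
    and t: "t0 \<le> t" and ft: "f t \<in> U" and gt: "g t \<in> U"
    and sides: "0 \<le> H (f t)" "H (g t) \<le> 0"
    and acc_f: "\<And>d. H (f t) = 0 \<Longrightarrow> d > 0 \<Longrightarrow> \<exists>h>0. h < d \<and> H (f (t + h)) = 0"
    and acc_g: "\<And>d. H (g t) = 0 \<Longrightarrow> d > 0 \<Longrightarrow> \<exists>h>0. h < d \<and> H (g (t + h)) = 0"
    and acc_fg: "\<And>d. H (f t) = 0 \<Longrightarrow> H (g t) = 0 \<Longrightarrow> d > 0 \<Longrightarrow>
      \<exists>h>0. h < d \<and> H (f (t + h)) = 0 \<and> H (g (t + h)) = 0"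
    and "d > 0"
  shows "\<exists>h>0. h < d \<and> 0 \<le> H (f (t + h)) \<and> H (g (t + h)) \<le> 0"
proof (cases "H (f t) = 0")
  case f0: True
  show ?thesis
  proof (cases "H (g t) = 0")
    case True
    then show ?thesis using acc_fg[OF f0 True \<open>d > 0\<close>] by force
  next
    case False
    then obtain d' where "d' > 0" and d': "\<And>h. 0 < h \<Longrightarrow> h < d' \<Longrightarrow> H (g (t + h)) < 0"
      using right_sign_persists(2)[OF g t gt] sides by auto
    obtain h where "h > 0" "h < min d d'" "H (f (t + h)) = 0"
      using acc_f[OF f0, of "min d d'"] \<open>d > 0\<close> \<open>d' > 0\<close> by auto
    then show ?thesis using d'[of h] by (intro exI[of _ h]) auto
  qed
next
  case False
  then obtain df where "df > 0" and df: "\<And>h. 0 < h \<Longrightarrow> h < df \<Longrightarrow> H (f (t + h)) > 0"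
    using right_sign_persists(1)[OF f t ft] sides by auto
  show ?thesis
  proof (cases "H (g t) = 0")
    case True
    obtain h where "h > 0" "h < min d df" "H (g (t + h)) = 0"
      using acc_g[OF True, of "min d df"] \<open>d > 0\<close> \<open>df > 0\<close> by auto
    then show ?thesis using df[of h] by (intro exI[of _ h]) auto
  next
    case False
    then obtain dg where "dg > 0" and dg: "\<And>h. 0 < h \<Longrightarrow> h < dg \<Longrightarrow> H (g (t + h)) < 0"
      using right_sign_persists(2)[OF g t gt] sides by auto
    define h where "h = Min {d, df, dg} / 2"
    have "h > 0" "h < d" "h < df" "h < dg"
      using \<open>d > 0\<close> \<open>df > 0\<close> \<open>dg > 0\<close> by (auto simp: h_def min_def)
    then show ?thesis using df[of h] dg[of h] by (intro exI[of _ h]) auto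
  qed
qed

text \<open>The roles of \<open>x\<close> and \<open>y\<close> can be exchanged, so the solution
  with the larger weight may be taken first.\<close>

lemma distance_step:
  assumes ball: "contracting_ball k p r" and xt: "x t \<in> ball p r" and yt: "y t \<in> ball p r"
    and dx: "(x has_vector_derivative velocity l (x t)) (at t within {t0..})"
    and dy: "(y has_vector_derivative velocity m (y t)) (at t within {t0..})"
    and t: "t0 \<le> t"
    and l: "filippov_weight H (x t) l" and m: "filippov_weight H (y t) m"
    and acc_x: "\<And>d. H (x t) = 0 \<Longrightarrow> d > 0 \<Longrightarrow> \<exists>h>0. h < d \<and> H (x (t + h)) = 0"
    and acc_y: "\<And>d. H (y t) = 0 \<Longrightarrow> d > 0 \<Longrightarrow> \<exists>h>0. h < d \<and> H (y (t + h)) = 0"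
    and acc_xy: "\<And>d. H (x t) = 0 \<Longrightarrow> H (y t) = 0 \<Longrightarrow> d > 0 \<Longrightarrow>
      \<exists>h>0. h < d \<and> H (x (t + h)) = 0 \<and> H (y (t + h)) = 0"
    and "e > 0" "d > 0"
  shows "\<exists>h>0. h < d \<and> N (x (t + h) - y (t + h)) \<le> (1 - h * k) * N (x t - y t) + e * h"
proof -
  have U: "x t \<in> U" "y t \<in> U" using ball xt yt by (auto simp: contracting_ball_def)
  note cx = has_vector_derivative_continuous[OF dx] and cy = has_vector_derivative_continuous[OF dy]
  \<comment> \<open>A positive weight \<open>l'\<close> excludes the negative side, and a weight
    \<open>m'\<close> below 1 excludes the positive side.\<close>
  have sides: "0 \<le> H a \<and> H b \<le> 0"
    if "filippov_weight H a l'" "filippov_weight H b m'" "m' < l'" for a b l' m'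
    using that by (auto simp: filippov_weight_def not_less[symmetric])
  have acc_yx: "\<exists>h>0. h < d \<and> H (y (t + h)) = 0 \<and> H (x (t + h)) = 0"
    if "H (y t) = 0" "H (x t) = 0" "d > 0" for d
    using acc_xy[of d] that by auto
  show ?thesis
  proof (cases "m \<le> l")
    case True
    show ?thesis
    proof (rule distance_step_ordered[OF ball xt yt dx dy t l m True _ \<open>e > 0\<close> \<open>d > 0\<close>])
      fix d' :: real assume "d' > 0" "m < l"
      then show "\<exists>h>0. h < d' \<and> 0 \<le> H (x (t + h)) \<and> H (y (t + h)) \<le> 0"
        using sides[OF l m]
        by (intro opposite_sides_right_frequently[OF cx cy t U _ _ acc_x acc_y acc_xy]) auto
    qed
  next
    case False
    have "\<exists>h>0. h < d \<and> N (y (t + h) - x (t + h)) \<le> (1 - h * k) * N (y t - x t) + e * h"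
    proof (rule distance_step_ordered[OF ball yt xt dy dx t m l _ _ \<open>e > 0\<close> \<open>d > 0\<close>])
      show "l \<le> m" using False by simp
      fix d' :: real assume "d' > 0" "l < m"
      then show "\<exists>h>0. h < d' \<and> 0 \<le> H (y (t + h)) \<and> H (x (t + h)) \<le> 0"
        using sides[OF m l]
        by (intro opposite_sides_right_frequently[OF cy cx t U(2,1) _ _ acc_y acc_x acc_yx]) auto
    qed
    then show ?thesis by (simp add: is_norm_minus_commute[OF N, of "y _"])
  qed
qed

section \<open>Exponential decay between nearby solutions\<close>

lemma solution_continuous_on:
  assumes "inclusion_solution U F {t0..} x"
  shows "continuous_on {t0..T} x"
proof (cases "t0 \<le> T")
  case True
  then show ?thesis
    using assms abs_continuous_on_imp_continuous_on unfolding inclusion_solution_def by fastforce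
qed simp

text \<open>The weighted distance \<open>g\<close> is absolutely continuous, and
  \<open>distance_step\<close> provides nearly nonincreasing steps outside a null set of times.
  Hence \<open>g\<close> is nonincreasing, which is the claimed decay.\<close>

lemma solutions_contract_in_balls:
  assumes x: "inclusion_solution U (bimodal_map U H fp fm) {t0..} x"
    and y: "inclusion_solution U (bimodal_map U H fp fm) {t0..} y"
    and T: "t0 \<le> T" and "k > 0"
    and balls: "\<And>t. t0 \<le> t \<Longrightarrow> t \<le> T \<Longrightarrow>
      \<exists>p r. contracting_ball k p r \<and> x t \<in> ball p r \<and> y t \<in> ball p r"
  shows "N (x T - y T) \<le> exp (- k * (T - t0)) * N (x t0 - y t0)"
proof -
  define \<E> where "\<E> t = exp (k * (t - t0))" for t
  define g where "g t = \<E> t * N (x t - y t)" for t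
  have AE_neg: "\<exists>Z. negligible Z \<and> (\<forall>t. t \<ge> t0 \<longrightarrow> t \<notin> Z \<longrightarrow>
      (\<exists>l. filippov_weight H (f t) l \<and> (f has_vector_derivative velocity l (f t)) (at t within {t0..})))"
    if f: "inclusion_solution U (bimodal_map U H fp fm) {t0..} f" for f
  proof -
    have "AE t in lebesgue. t \<in> {t0..} \<longrightarrow> (\<exists>v\<in>bimodal_map U H fp fm (f t).
        (f has_vector_derivative v) (at t within {t0..}))"
      using f by (simp add: inclusion_solution_def)
    then obtain Z where Z: "Z \<in> null_sets lebesgue"
      "{t \<in> space lebesgue. \<not> (t \<in> {t0..} \<longrightarrow> (\<exists>v\<in>bimodal_map U H fp fm (f t).
        (f has_vector_derivative v) (at t within {t0..})))} \<subseteq> Z"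
      unfolding eventually_ae_filter by blast
    have "\<exists>l. filippov_weight H (f t) l \<and> (f has_vector_derivative velocity l (f t)) (at t within {t0..})"
      if t: "t \<ge> t0" "t \<notin> Z" for t
    proof -
      obtain v where v: "v \<in> bimodal_map U H fp fm (f t)"
        "(f has_vector_derivative v) (at t within {t0..})" using Z(2) t by auto
      have "f t \<in> U" using f t by (simp add: inclusion_solution_def)
      then show ?thesis
        using bimodal_map_weight[OF open_U _ cont_H cont_fp cont_fm v(1)] v(2)
        unfolding velocity_def by auto
    qed
    then show ?thesis using Z(1) by (auto simp: negligible_iff_null_sets)
  qed
  obtain Zx where Zx: "negligible Zx" "\<And>t. t \<ge> t0 \<Longrightarrow> t \<notin> Zx \<Longrightarrow> \<exists>l. filippov_weight H (x t) l \<and>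
      (x has_vector_derivative velocity l (x t)) (at t within {t0..})" using AE_neg[OF x] by blast
  obtain Zy where Zy: "negligible Zy" "\<And>t. t \<ge> t0 \<Longrightarrow> t \<notin> Zy \<Longrightarrow> \<exists>l. filippov_weight H (y t) l \<and>
      (y has_vector_derivative velocity l (y t)) (at t within {t0..})" using AE_neg[OF y] by blast
  define I where "I A = {t \<in> A. \<exists>d>0. {t<..<t + d} \<inter> A = {}}" for A :: "real set"
  have I: "\<exists>h>0. h < d \<and> t + h \<in> A" if t: "t \<in> A" "t \<notin> I A" "d > 0" for t d A
  proof -
    have "{t<..<t + d} \<inter> A \<noteq> {}" using t unfolding I_def by blast
    then obtain s where "s \<in> {t<..<t + d} \<inter> A" by blast
    then show ?thesis by (intro exI[of _ "s - t"]) auto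
  qed
  define Ax where "Ax = {t. H (x t) = 0}"
  define Ay where "Ay = {t. H (y t) = 0}"
  \<comment> \<open>Excluded are the times without a Filippov velocity and the right-isolated points
    of three sets: the times when \<open>x\<close>, when \<open>y\<close> and when both are on the
    manifold. At the remaining times the accumulation assumptions of \<open>distance_step\<close>
    hold.\<close>
  define Z where "Z = Zx \<union> Zy \<union> (I Ax \<union> I Ay \<union> I (Ax \<inter> Ay))"
  have "negligible Z"
  proof -
    have "negligible (I A)" for A
      unfolding negligible_iff_null_sets I_def
      by (intro null_sets_completionI countable_imp_null_set_lborel countable_right_isolated)
    then show ?thesis unfolding Z_def using Zx(1) Zy(1) by (intro negligible_Un)
  qed
  have ac: "abs_continuous_on t0 T x" "abs_continuous_on t0 T y"
    using x y T by (auto simp: inclusion_solution_def)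
  have "abs_continuous_on t0 T g"
  proof -
    obtain M where M: "M > 0" "\<And>v. N v \<le> M * norm v" "\<And>v w. \<bar>N v - N w\<bar> \<le> M * norm (v - w)"
      using is_norm_lipschitz[OF N] by blast
    have "continuous_on {t0..T} (\<lambda>t. N (x t - y t))"
      using solution_continuous_on[OF x] solution_continuous_on[OF y]
      by (intro continuous_on_compose2[OF is_norm_continuous_on[OF N, of UNIV]] continuous_on_diff) auto
    from continuous_attains_sup[OF compact_Icc _ this] T
    obtain s where s: "\<forall>t\<in>{t0..T}. N (x t - y t) \<le> N (x s - y s)" by auto
    define B where "B = N (x s - y s)"
    have B: "N (x t - y t) \<le> B" if "t0 \<le> t" "t \<le> T" for t
      using s that by (simp add: B_def)
    have "B \<ge> 0" using B[of t0] T is_norm_nonneg[OF N, of "x t0 - y t0"] by simp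
    \<comment> \<open>The first summand covers the change of the distance, the second the change of
      the exponential weight, where \<open>B\<close> bounds the distance.\<close>
    define L where "L = \<E> T * M + k * \<E> T * B"
    have \<E>: "\<E> t > 0" "t \<le> s \<Longrightarrow> \<E> t \<le> \<E> s" for s t using \<open>k > 0\<close> by (auto simp: \<E>_def)
    have "L > 0" using \<E>(1) M(1) \<open>k > 0\<close> \<open>B \<ge> 0\<close> by (simp add: L_def add_pos_nonneg less_imp_le)
    show ?thesis
    proof (rule abs_continuous_on_dominated[OF ac \<open>L > 0\<close>])
      fix s t assume st: "t0 \<le> s" "s \<le> t" "t \<le> T"
      have "\<E> t - \<E> s \<le> \<E> t * (k * (t - s))"
      proof -
        have "\<E> s = \<E> t * exp (- (k * (t - s)))" by (simp add: \<E>_def algebra_simps flip: exp_add)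
        moreover have "1 - k * (t - s) \<le> exp (- (k * (t - s)))"
          using exp_ge_add_one_self[of "- (k * (t - s))"] by simp
        ultimately have "\<E> t * (1 - k * (t - s)) \<le> \<E> s" using \<E>(1)[of t] by simp
        then show ?thesis by (simp add: right_diff_distrib)
      qed
      also have "\<dots> \<le> \<E> T * (k * (t - s))"
        using st \<open>k > 0\<close> \<E>(2)[of t T] by (intro mult_right_mono) auto
      finally have E_diff: "\<bar>\<E> t - \<E> s\<bar> \<le> k * \<E> T * (t - s)" using \<E>(2)[OF st(2)] by (simp add: mult_ac)
      have "\<bar>N (x t - y t) - N (x s - y s)\<bar> \<le> M * norm ((x t - y t) - (x s - y s))" by (rule M)
      also have "\<dots> \<le> M * (norm (x t - x s) + norm (y t - y s))"
        using M(1) norm_triangle_ineq4[of "x t - x s" "y t - y s"]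
        by (intro mult_left_mono) (auto simp: algebra_simps)
      finally have m_diff: "\<bar>N (x t - y t) - N (x s - y s)\<bar> \<le> M * (norm (x t - x s) + norm (y t - y s))" .
      have "g t - g s = \<E> t * (N (x t - y t) - N (x s - y s)) + (\<E> t - \<E> s) * N (x s - y s)"
        by (simp add: g_def algebra_simps)
      then have "\<bar>g t - g s\<bar> \<le> \<E> t * \<bar>N (x t - y t) - N (x s - y s)\<bar> + \<bar>\<E> t - \<E> s\<bar> * N (x s - y s)"
        using abs_triangle_ineq[of "\<E> t * (N (x t - y t) - N (x s - y s))" "(\<E> t - \<E> s) * N (x s - y s)"]
          \<E>(1)[of t] is_norm_nonneg[OF N, of "x s - y s"] by (simp add: abs_mult)
      also have "\<dots> \<le> \<E> T * (M * (norm (x t - x s) + norm (y t - y s))) + (k * \<E> T * (t - s)) * B"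
        using m_diff E_diff \<E>(1) \<E>(2)[OF st(3)] B[of s] st \<open>k > 0\<close> is_norm_nonneg[OF N]
        by (intro add_mono mult_mono) (auto intro: less_imp_le)
      also have "\<dots> \<le> L * (norm (x t - x s) + norm (y t - y s)) + L * (t - s)"
      proof (rule add_mono)
        show "\<E> T * (M * (norm (x t - x s) + norm (y t - y s))) \<le> L * (norm (x t - x s) + norm (y t - y s))"
          unfolding L_def mult.assoc[symmetric] using \<E>(1)[of T] \<open>k > 0\<close> \<open>B \<ge> 0\<close> by (intro mult_right_mono) auto
        have "k * \<E> T * B * (t - s) \<le> L * (t - s)"
          unfolding L_def using \<E>(1)[of T] M(1) st by (intro mult_right_mono) auto
        then show "(k * \<E> T * (t - s)) * B \<le> L * (t - s)" by (simp add: mult_ac)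
      qed
      finally show "\<bar>g t - g s\<bar> \<le> L * (norm (x t - x s) + norm (y t - y s) + (t - s))"
        by (simp add: distrib_left)
    qed
  qed
  have "g T \<le> g t0"
  proof (rule abs_continuous_nonincreasing[OF T \<open>abs_continuous_on t0 T g\<close> \<open>negligible Z\<close>])
    fix t e :: real assume t: "t0 \<le> t" "t < T" "t \<notin> Z" and "e > 0"
    obtain l where l: "filippov_weight H (x t) l" "(x has_vector_derivative velocity l (x t)) (at t within {t0..})"
      using Zx(2)[OF t(1)] t(3) by (auto simp: Z_def)
    obtain m where m: "filippov_weight H (y t) m" "(y has_vector_derivative velocity m (y t)) (at t within {t0..})"
      using Zy(2)[OF t(1)] t(3) by (auto simp: Z_def)
    obtain p r where b: "contracting_ball k p r" "x t \<in> ball p r" "y t \<in> ball p r"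
      using balls[of t] t by auto
    \<comment> \<open>Compensates the factor \<open>\<E> t * exp (h * k)\<close> by which the error
      is multiplied; \<open>h < 1\<close> bounds it by \<open>\<E> t * exp k\<close>.\<close>
    define e' where "e' = e / (\<E> t * exp k)"
    have "e' > 0" using \<open>e > 0\<close> by (simp add: e'_def \<E>_def)
    have "min 1 (T - t) > 0" using t by simp
    have "\<exists>h>0. h < min 1 (T - t) \<and> N (x (t + h) - y (t + h)) \<le> (1 - h * k) * N (x t - y t) + e' * h"
    proof (rule distance_step[OF b l(2) m(2) t(1) l(1) m(1) _ _ _ \<open>e' > 0\<close> \<open>min 1 (T - t) > 0\<close>])
      fix d :: real assume "d > 0"
      show "\<exists>h>0. h < d \<and> H (x (t + h)) = 0" if "H (x t) = 0"
        using I[of t Ax d] that t(3) \<open>d > 0\<close> by (auto simp: Z_def Ax_def)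
      show "\<exists>h>0. h < d \<and> H (y (t + h)) = 0" if "H (y t) = 0"
        using I[of t Ay d] that t(3) \<open>d > 0\<close> by (auto simp: Z_def Ay_def)
      show "\<exists>h>0. h < d \<and> H (x (t + h)) = 0 \<and> H (y (t + h)) = 0" if "H (x t) = 0" "H (y t) = 0"
        using I[of t "Ax \<inter> Ay" d] that t(3) \<open>d > 0\<close> by (auto simp: Z_def Ax_def Ay_def)
    qed
    then obtain h where h: "h > 0" "h < 1" "h < T - t"
      and step: "N (x (t + h) - y (t + h)) \<le> (1 - h * k) * N (x t - y t) + e' * h" by auto
    have exp_h: "exp (h * k) * (1 - h * k) \<le> 1"
    proof -
      have "exp (h * k) * (1 - h * k) \<le> exp (h * k) * exp (- (h * k))"
        using exp_ge_add_one_self[of "- (h * k)"] by (intro mult_left_mono) auto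
      then show ?thesis by (simp flip: exp_add)
    qed
    have "g (t + h) = \<E> t * (exp (h * k) * N (x (t + h) - y (t + h)))"
      by (simp add: g_def \<E>_def algebra_simps flip: exp_add)
    also have "\<dots> \<le> \<E> t * (exp (h * k) * ((1 - h * k) * N (x t - y t) + e' * h))"
      using step by (intro mult_left_mono) (auto simp: \<E>_def)
    also have "\<dots> = \<E> t * ((exp (h * k) * (1 - h * k)) * N (x t - y t) + exp (h * k) * (e' * h))"
      by (simp add: algebra_simps)
    also have "\<dots> \<le> \<E> t * (1 * N (x t - y t) + exp k * (e' * h))"
      using exp_h h \<open>e' > 0\<close> \<open>k > 0\<close> is_norm_nonneg[OF N]
      by (intro mult_left_mono add_mono mult_right_mono) (auto simp: \<E>_def)
    also have "\<dots> = g t + e * h" by (simp add: g_def e'_def \<E>_def field_simps)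
    finally show "\<exists>h>0. t + h \<le> T \<and> g (t + h) - g t \<le> e * h" using h by (intro exI[of _ h]) auto
  qed
  then have "exp (k * (T - t0)) * N (x T - y T) \<le> N (x t0 - y t0)" by (simp add: g_def \<E>_def)
  then have "exp (- k * (T - t0)) * (exp (k * (T - t0)) * N (x T - y T)) \<le> exp (- k * (T - t0)) * N (x t0 - y t0)"
    by (intro mult_left_mono) auto
  then show ?thesis by (simp flip: mult.assoc exp_add)
qed

text \<open>The trajectory over a bounded time interval is compact and covered by contracting balls;
  \<open>r\<close> is a Lebesgue number of this cover.\<close>

lemma contracting_balls_along_solution:
  assumes x: "inclusion_solution U (bimodal_map U H fp fm) {t0..} x" and "k < c"
  shows "\<exists>r>0. \<forall>t q. t0 \<le> t \<longrightarrow> t \<le> T \<longrightarrow> dist (x t) q < r \<longrightarrow>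
    (\<exists>p r'. contracting_ball k p r' \<and> x t \<in> ball p r' \<and> q \<in> ball p r')"
proof -
  have "compact (x ` {t0..T})"
    using solution_continuous_on[OF x] by (intro compact_continuous_image) auto
  moreover have "x ` {t0..T} \<subseteq> \<Union>{B. \<exists>p r. contracting_ball k p r \<and> B = ball p r}"
  proof (rule image_subsetI)
    fix t assume "t \<in> {t0..T}"
    then have "x t \<in> U" using x by (simp add: inclusion_solution_def)
    then obtain r where "contracting_ball k (x t) r" using contracting_ball_exists \<open>k < c\<close> by blast
    moreover from this have "x t \<in> ball (x t) r" by (simp add: contracting_ball_def)
    ultimately show "x t \<in> \<Union>{B. \<exists>p r. contracting_ball k p r \<and> B = ball p r}" by blast
  qed
  ultimately obtain r where "r > 0" and
    r: "\<forall>z\<in>x ` {t0..T}. \<exists>B\<in>{B. \<exists>p r. contracting_ball k p r \<and> B = ball p r}. ball z r \<subseteq> B"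
    by (rule Heine_Borel_lemma) auto
  have "\<exists>p r'. contracting_ball k p r' \<and> x t \<in> ball p r' \<and> q \<in> ball p r'"
    if t: "t0 \<le> t" "t \<le> T" "dist (x t) q < r" for t q
  proof -
    have "x t \<in> x ` {t0..T}" using t by simp
    then obtain p r' where p: "contracting_ball k p r'" "ball (x t) r \<subseteq> ball p r'" using r by blast
    have "x t \<in> ball (x t) r" "q \<in> ball (x t) r" using t(3) \<open>r > 0\<close> by auto
    then show ?thesis using p by blast
  qed
  then show ?thesis using \<open>r > 0\<close> by blast
qed

text \<open>A continuation argument: while \<open>y\<close> stays within \<open>\<rho>\<close> of
  \<open>x\<close>, both lie in common contracting balls and their distance does not exceed the
  initial one. So there is no first time at which the distance reaches \<open>\<rho>\<close>. The
  radius depends on \<open>x\<close> and \<open>T\<close>.\<close>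

lemma nearby_solutions_contract:
  assumes x: "inclusion_solution U (bimodal_map U H fp fm) {t0..} x"
    and "t0 \<le> T" "0 < k" "k < c"
  shows "\<exists>\<rho>>0. \<forall>y. inclusion_solution U (bimodal_map U H fp fm) {t0..} y \<longrightarrow> N (x t0 - y t0) < \<rho> \<longrightarrow>
    N (x T - y T) \<le> exp (- k * (T - t0)) * N (x t0 - y t0)"
proof -
  obtain r where "r > 0" and r: "\<And>t q. t0 \<le> t \<Longrightarrow> t \<le> T \<Longrightarrow> dist (x t) q < r \<Longrightarrow>
    \<exists>p r'. contracting_ball k p r' \<and> x t \<in> ball p r' \<and> q \<in> ball p r'"
    using contracting_balls_along_solution[OF x \<open>k < c\<close>, of T] by blast
  obtain M where M: "M > 0" "\<And>v. norm v \<le> M * N v" using is_norm_ge_norm[OF N] by blast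
  define \<rho> where "\<rho> = r / M"
  have "\<rho> > 0" using \<open>r > 0\<close> M(1) by (simp add: \<rho>_def)
  have close: "dist v w < r" if "N (v - w) < \<rho>" for v w
  proof -
    have "norm (v - w) \<le> M * N (v - w)" by (rule M)
    also have "\<dots> < M * \<rho>" using that M(1) by simp
    also have "\<dots> = r" using M(1) by (simp add: \<rho>_def)
    finally show ?thesis by (simp add: dist_norm)
  qed
  have "N (x T - y T) \<le> exp (- k * (T - t0)) * N (x t0 - y t0)"
    if y: "inclusion_solution U (bimodal_map U H fp fm) {t0..} y" and y0: "N (x t0 - y t0) < \<rho>" for y
  proof -
    have contract: "N (x \<tau> - y \<tau>) \<le> exp (- k * (\<tau> - t0)) * N (x t0 - y t0)"
      if "t0 \<le> \<tau>" "\<tau> \<le> T" "\<And>t. t0 \<le> t \<Longrightarrow> t \<le> \<tau> \<Longrightarrow> N (x t - y t) < \<rho>" for \<tau>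
      using that close by (intro solutions_contract_in_balls[OF x y _ \<open>0 < k\<close>] r) auto
    define S where "S = {t \<in> {t0..T}. N (x t - y t) \<in> {\<rho>..}}"
    have cont: "continuous_on {t0..T} (\<lambda>t. N (x t - y t))"
      using solution_continuous_on[OF x] solution_continuous_on[OF y]
      by (intro continuous_on_compose2[OF is_norm_continuous_on[OF N, of UNIV]] continuous_on_diff) auto
    have "S = {}"
    proof (rule ccontr)
      assume "S \<noteq> {}"
      have "closed S"
        using continuous_closed_preimage[OF cont, of "{\<rho>..}"] by (simp add: S_def vimage_def Int_def)
      moreover have "bounded S" unfolding S_def by (rule bounded_subset[of "{t0..T}"]) auto
      ultimately have "compact S" by (simp add: compact_eq_bounded_closed)
      from compact_attains_inf[OF this \<open>S \<noteq> {}\<close>] obtain \<tau> where \<tau>: "\<tau> \<in> S" "\<forall>t\<in>S. \<tau> \<le> t" by blast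
      have "\<tau> \<noteq> t0" using \<tau>(1) y0 by (auto simp: S_def)
      then have "t0 < \<tau>" using \<tau>(1) by (simp add: S_def)
      have before: "N (x t - y t) \<le> N (x t0 - y t0)" if t: "t0 \<le> t" "t < \<tau>" for t
      proof -
        have "N (x s - y s) < \<rho>" if s: "t0 \<le> s" "s \<le> t" for s
        proof -
          have "s \<notin> S" using \<tau>(2) s t by auto
          then show ?thesis using s t \<tau>(1) by (auto simp: S_def)
        qed
        then have "N (x t - y t) \<le> exp (- k * (t - t0)) * N (x t0 - y t0)"
          using t \<tau>(1) by (intro contract) (auto simp: S_def)
        also have "\<dots> \<le> 1 * N (x t0 - y t0)"
          using t \<open>0 < k\<close> is_norm_nonneg[OF N] by (intro mult_right_mono) auto
        finally show ?thesis by simp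
      qed
      \<comment> \<open>Before \<open>\<tau>\<close> the distance is at most its initial value, at
        \<open>\<tau>\<close> it is at least \<open>\<rho>\<close>; continuity cannot bridge this
        gap.\<close>
      have "\<rho> - N (x t0 - y t0) > 0" using y0 by simp
      then obtain \<delta> where "\<delta> > 0" and \<delta>: "\<forall>s\<in>{t0..T}. dist s \<tau> < \<delta> \<longrightarrow>
          dist (N (x s - y s)) (N (x \<tau> - y \<tau>)) < \<rho> - N (x t0 - y t0)"
        using cont \<tau>(1) unfolding continuous_on_iff S_def by blast
      define s where "s = max t0 (\<tau> - \<delta> / 2)"
      have s: "t0 \<le> s" "s < \<tau>" "dist s \<tau> < \<delta>" using \<open>\<delta> > 0\<close> \<open>t0 < \<tau>\<close> by (auto simp: s_def dist_real_def)
      moreover have "s \<in> {t0..T}" using s \<tau>(1) by (auto simp: S_def)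
      ultimately have "\<bar>N (x s - y s) - N (x \<tau> - y \<tau>)\<bar> < \<rho> - N (x t0 - y t0)"
        using \<delta> by (auto simp: dist_real_def)
      then show False using before[OF s(1,2)] \<tau>(1) by (auto simp: S_def)
    qed
    then show ?thesis using \<open>t0 \<le> T\<close> by (intro contract) (auto simp: S_def not_le[symmetric])
  qed
  then show ?thesis using \<open>\<rho> > 0\<close> by blast
qed

text \<open>Solutions issuing from the points of the path form a family \<open>\<Phi>\<close>. Near
  each member the local contraction bounds the dilation of its state at time \<open>T\<close>, as a
  function of the path parameter, by the exponential factor times \<open>L\<close>; the radius of
  validity may vary along the path.\<close>

lemma solutions_contract_along_path:
  assumes x: "inclusion_solution U (bimodal_map U H fp fm) {t0..} x"
    and y: "inclusion_solution U (bimodal_map U H fp fm) {t0..} y"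
    and "t0 \<le> T" "0 < k" "k < c"
    and \<gamma>: "\<gamma> 0 = x t0" "\<gamma> 1 = y t0"
    and sol: "\<And>r. r \<in> {0..1} \<Longrightarrow> \<exists>z. inclusion_solution U (bimodal_map U H fp fm) {t0..} z \<and> z t0 = \<gamma> r"
    and deriv: "\<And>r. r \<in> {0..1} \<Longrightarrow> (\<gamma> has_vector_derivative \<gamma>' r) (at r within {0..1})"
    and bound: "\<And>r. r \<in> {0..1} \<Longrightarrow> N (\<gamma>' r) \<le> L"
  shows "N (x T - y T) \<le> exp (- k * (T - t0)) * L"
proof -
  let ?sol = "inclusion_solution U (bimodal_map U H fp fm) {t0..}"
  define E where "E = exp (- k * (T - t0))"
  have "E > 0" by (simp add: E_def)
  \<comment> \<open>At the ends of the path the given solutions are selected, so that the family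
    joins \<open>x\<close> to \<open>y\<close>.\<close>
  have "\<exists>z. ?sol z \<and> z t0 = \<gamma> r \<and> (r = 0 \<longrightarrow> z = x) \<and> (r = 1 \<longrightarrow> z = y)" if r: "r \<in> {0..1}" for r
  proof -
    consider "r = 0" | "r = 1" | "r \<noteq> 0" "r \<noteq> 1" by blast
    then show ?thesis using sol[OF r] x y \<gamma> by cases auto
  qed
  then have "\<forall>r\<in>{0..1}. \<exists>z. ?sol z \<and> z t0 = \<gamma> r \<and> (r = 0 \<longrightarrow> z = x) \<and> (r = 1 \<longrightarrow> z = y)" by blast
  from bchoice[OF this] obtain \<Phi> where \<Phi>: "\<forall>r\<in>{0..1}. ?sol (\<Phi> r) \<and> \<Phi> r t0 = \<gamma> r \<and>
      (r = 0 \<longrightarrow> \<Phi> r = x) \<and> (r = 1 \<longrightarrow> \<Phi> r = y)" by blast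
  have "L \<ge> 0" using bound[of 0] is_norm_nonneg[OF N, of "\<gamma>' 0"] by simp
  have "N (\<Phi> 1 T - \<Phi> 0 T) \<le> (E * L) * (1 - 0)"
  proof (rule is_norm_path_diff_le[OF N])
    fix r e :: real assume r: "0 \<le> r" "r \<le> 1" and "e > 0"
    have sol_r: "?sol (\<Phi> r)" using \<Phi> r by auto
    obtain \<rho> where "\<rho> > 0" and \<rho>: "\<And>z. ?sol z \<Longrightarrow> N (\<Phi> r t0 - z t0) < \<rho> \<Longrightarrow>
        N (\<Phi> r T - z T) \<le> E * N (\<Phi> r t0 - z t0)"
      using nearby_solutions_contract[OF sol_r \<open>t0 \<le> T\<close> \<open>0 < k\<close> \<open>k < c\<close>] unfolding E_def by blast
    have "e / E > 0" using \<open>e > 0\<close> \<open>E > 0\<close> by simp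
    obtain d where "d > 0" and d: "\<forall>s\<in>{0..1}. \<bar>s - r\<bar> < d \<longrightarrow>
        N (\<gamma> s - \<gamma> r - (s - r) *\<^sub>R \<gamma>' r) \<le> e / E * \<bar>s - r\<bar>"
      using has_vector_derivative_is_norm_le[OF N deriv[of r] \<open>e / E > 0\<close>] r by auto
    \<comment> \<open>The second bound keeps the initial values within the radius
      \<open>\<rho>\<close> of the local contraction.\<close>
    define d' where "d' = min d (\<rho> / (L + e / E))"
    have pos: "L + e / E > 0" using \<open>L \<ge> 0\<close> \<open>e / E > 0\<close> by simp
    then have "d' > 0" using \<open>d > 0\<close> \<open>\<rho> > 0\<close> by (simp add: d'_def)
    have "N (\<Phi> s T - \<Phi> r T) \<le> (E * L + e) * \<bar>s - r\<bar>" if s: "s \<in> {0..1}" "\<bar>s - r\<bar> < d'" for s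
    proof -
      have "N (\<gamma> s - \<gamma> r) \<le> N ((s - r) *\<^sub>R \<gamma>' r) + N (\<gamma> s - \<gamma> r - (s - r) *\<^sub>R \<gamma>' r)"
        by (rule is_norm_triangle_sub[OF N])
      also have "\<dots> \<le> \<bar>s - r\<bar> * L + e / E * \<bar>s - r\<bar>"
        using d s bound[of r] r by (intro add_mono) (auto simp: d'_def is_norm_scaleR[OF N] mult_left_mono)
      finally have \<gamma>_diff: "N (\<gamma> r - \<gamma> s) \<le> (L + e / E) * \<bar>s - r\<bar>"
        by (simp add: algebra_simps is_norm_minus_commute[OF N, of "\<gamma> r"])
      also have "\<dots> < \<rho>" using s(2) pos by (simp add: d'_def pos_less_divide_eq mult.commute)
      finally have "N (\<Phi> r T - \<Phi> s T) \<le> E * N (\<gamma> r - \<gamma> s)"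
        using \<rho>[of "\<Phi> s"] \<Phi> s(1) r by auto
      also have "\<dots> \<le> E * ((L + e / E) * \<bar>s - r\<bar>)" using \<gamma>_diff \<open>E > 0\<close> by (intro mult_left_mono) auto
      also have "\<dots> = (E * L + e) * \<bar>s - r\<bar>" using \<open>E > 0\<close> by (simp add: field_simps)
      finally show ?thesis by (simp add: is_norm_minus_commute[OF N, of "\<Phi> s T"])
    qed
    then show "\<exists>d>0. \<forall>s\<in>{0..1}. \<bar>s - r\<bar> < d \<longrightarrow> N (\<Phi> s T - \<Phi> r T) \<le> (E * L + e) * \<bar>s - r\<bar>"
      using \<open>d' > 0\<close> by blast
  qed (use \<open>E > 0\<close> \<open>L \<ge> 0\<close> in auto)
  moreover have "\<Phi> 0 = x" "\<Phi> 1 = y" using \<Phi> by auto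
  ultimately show ?thesis by (simp add: E_def is_norm_minus_commute[OF N, of "x T"])
qed

end

section \<open>The global estimate in the reachable set\<close>

theorem theorem6:
  fixes U C :: "(real^'n) set"
    and H N :: "real^'n \<Rightarrow> real"
    and fp fm :: "real^'n \<Rightarrow> real^'n"
    and K c1 c2 :: real
  assumes "open U"
    and "Ck_on 1 fp U" and "Ck_on 1 fm U"
    and "smooth_on H U"
    and "\<forall>x\<in>switching_manifold U H. grad H x \<noteq> 0"
    and "right_uniqueness U (bimodal_map U H fp fm)"
    and "is_norm N"
    and "C \<subseteq> U"
    and "forward_invariant U (bimodal_map U H fp fm) C"
    and "K_reachable N K C"
    and "c1 > 0" and "c2 > 0"
    and "\<forall>x\<in>closure (S_plus U H) \<inter> U. matrix_measure N (jacobian fp (at x)) \<le> - c1"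
    and "\<forall>x\<in>closure (S_minus U H) \<inter> U. matrix_measure N (jacobian fm (at x)) \<le> - c2"
    and "\<forall>x\<in>switching_manifold U H.
           matrix_measure N (columnvector (fp x - fm x) ** rowvector (grad H x)) = 0"
  shows "incr_exp_stable N U (bimodal_map U H fp fm) C (min c1 c2)"
proof -
  define c where "c = min c1 c2"
  have "c > 0" "c \<le> c1" "c \<le> c2" using assms(11,12) by (auto simp: c_def)
  note N = \<open>is_norm N\<close>
  have jump: "N W \<le> N (W - a *\<^sub>R (fp x - fm x))"
    if x: "x \<in> U" "H x = 0" and "grad H x \<bullet> W \<ge> 0" "a \<ge> 0" for x W a
  proof -
    have "x \<in> switching_manifold U H" using x by (simp add: switching_manifold_def)
    \<comment> \<open>The product acts through the gradient scaled by its inner dimension, a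
      positive number, which changes neither the sign condition nor regularity.\<close>
    then show ?thesis
      using assms(5) that
      by (intro rank_one_measure_zero[OF N assms(15)[rule_format] columnvector_rowvector_mult]) auto
  qed
  interpret bimodal_contraction U H N fp fm c
  proof
    show "H differentiable (at x)" if "x \<in> U" for x
      using \<open>smooth_on H U\<close> that unfolding smooth_on_def by (metis Ck_on.simps(2))
    show "grad H x \<noteq> 0" if "x \<in> U" "H x = 0" for x
      using assms(5) that by (auto simp: switching_manifold_def)
    show "matrix_measure N (jacobian fp (at x)) \<le> - c" if "x \<in> closure (S_plus U H)" "x \<in> U" for x
      using bspec[OF assms(13), of x] that \<open>c \<le> c1\<close> by simp
    show "matrix_measure N (jacobian fm (at x)) \<le> - c" if "x \<in> closure (S_minus U H)" "x \<in> U" for x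
      using bspec[OF assms(14), of x] that \<open>c \<le> c2\<close> by simp
  qed (use assms jump in auto)
  have "N (x t - y t) \<le> max 1 K * exp (- c * (t - t0)) * N (x t0 - y t0)"
    if x: "inclusion_solution U (bimodal_map U H fp fm) {t0..} x"
      and y: "inclusion_solution U (bimodal_map U H fp fm) {t0..} y"
      and C: "x t0 \<in> C" "y t0 \<in> C" and t: "t0 \<le> t" for t0 t x y
  proof -
    obtain \<gamma> \<gamma>' where \<gamma>: "\<And>r. r \<in> {0..1} \<Longrightarrow> \<gamma> r \<in> C" "\<gamma> 0 = x t0" "\<gamma> 1 = y t0"
      "\<And>r. r \<in> {0..1} \<Longrightarrow> (\<gamma> has_vector_derivative \<gamma>' r) (at r within {0..1})"
      "\<And>r. r \<in> {0..1} \<Longrightarrow> N (\<gamma>' r) \<le> K * N (y t0 - x t0)"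
      using \<open>K_reachable N K C\<close> C unfolding K_reachable_def by metis
    have sol: "\<exists>z. inclusion_solution U (bimodal_map U H fp fm) {t0..} z \<and> z t0 = \<gamma> r"
      if "r \<in> {0..1}" for r
      using \<open>forward_invariant U (bimodal_map U H fp fm) C\<close> \<gamma>(1)[OF that]
      unfolding forward_invariant_def by blast
    have le: "N (x t - y t) \<le> exp (- k * (t - t0)) * (K * N (y t0 - x t0))" if "0 < k" "k < c" for k
      by (rule solutions_contract_along_path[OF x y t that \<gamma>(2,3) sol \<gamma>(4,5)])
    \<comment> \<open>The local contraction reaches only rates below \<open>c\<close>; since the
      factor \<open>K\<close> does not depend on \<open>k\<close>, letting \<open>k\<close> tend to
      \<open>c\<close> gives the full rate.\<close>
    have "((\<lambda>k. exp (- k * (t - t0)) * (K * N (y t0 - x t0))) \<longlongrightarrow>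
        exp (- c * (t - t0)) * (K * N (y t0 - x t0))) (at_left c)"
      by (intro tendsto_intros)
    moreover have "eventually (\<lambda>k. N (x t - y t) \<le> exp (- k * (t - t0)) * (K * N (y t0 - x t0))) (at_left c)"
      unfolding eventually_at_left_field using le \<open>c > 0\<close> by (intro exI[of _ 0]) auto
    ultimately have "N (x t - y t) \<le> exp (- c * (t - t0)) * (K * N (y t0 - x t0))"
      by (intro tendsto_lowerbound) auto
    \<comment> \<open>The stability constant has to be at least 1, while \<open>K\<close> is only
      known to be positive.\<close>
    also have "\<dots> \<le> exp (- c * (t - t0)) * (max 1 K * N (y t0 - x t0))"
      using is_norm_nonneg[OF N] by (intro mult_left_mono mult_right_mono) auto
    finally show ?thesis by (simp add: mult_ac is_norm_minus_commute[OF N, of "x t0"])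
  qed
  then show ?thesis
    using \<open>c > 0\<close> \<open>forward_invariant U (bimodal_map U H fp fm) C\<close>
    unfolding incr_exp_stable_def c_def by (intro conjI exI[of _ "max 1 K"]) auto
qed

end
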